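(* Let $\Phi$ be a Young function and let $m:\Sigma\to Y$ be a countably additive vector measure defined on a $\sigma$-algebra $\Sigma$ of subsets of a nonempty set $\Omega$ with values in a real Banach space $Y$. (i) $L^{\Phi}_w(m)=L^1_w(m)^{\Phi}$ and $\|f\|_{L^{\Phi}_w(m)}=\|f\|_{L^1_w(m)^{\Phi}}$ for all $f\in L^{\Phi}_w(m)$. (ii) $L^{\Phi}(m)\subseteq L^1(m)^{\Phi}$, and if $\Phi\in\Delta_2$, then $L^{\Phi}(m)=L^1(m)^{\Phi}$.
   Context: A Young function is a function $\Phi:[0,\infty)\to[0,\infty)$ that is strictly increasing, continuous, convex, with $\Phi(0)=0$ and $\lim_{t\to\infty}\Phi(t)=\infty$. $\Phi\in\Delta_2$ means there is $C>1$ with $\Phi(2t)\le C\Phi(t)$ for all $t\ge 0$. Vector measures. For $y^*\in Y^*$, $\langle m,y^*\rangle(A):=\langle m(A),y^*\rangle$, with variation $|\langle m,y^*\rangle|$; $B_{Y^*}$ is the closed unit ball of $Y^*$. The semivariation is $\|m\|(A):=\sup\{|\langle m,y^*\rangle|(A):y^*\in B_{Y^*}\}$; $A$ is $m$-null if $\|m\|(A)=0$. $L^0(m)$ is the space of $m$-a.e. classes of measurable functions $f:\Omega\to\mathbb{R}$. A Rybakov control measure for $m$ is a measure $\mu=|\langle m,y_0^*\rangle|$, $y_0^*\in B_{Y^*}$, with $\|m\|(A)\to0$ iff $\mu(A)\to 0$; one always exists, and $L^0(m)=L^0(\mu)$. A measurable $f$ is weakly integrable if $f\in L^1(|\langle m,y^*\rangle|)$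 for all $y^*\in Y^*$; it is integrable if moreover for each $A\in\Sigma$ there is $\int_A f\,dm\in Y$ with $\langle\int_A f\,dm,y^*\rangle=\int_A f\,d\langle m,y^*\rangle$ for all $y^*\in Y^*$. $L^1_w(m)$ and $L^1(m)$ are the spaces of ($m$-a.e. classes of) weakly integrable, respectively integrable, functions, both with the norm $\|f\|_{L^1_w(m)}:=\sup\{\int_\Omega|f|\,d|\langle m,y^*\rangle|:y^*\in B_{Y^*}\}$. Both are Banach function spaces over any Rybakov control measure $\mu$ of $m$ (that is, complete normed spaces which are ideals in $L^0(\mu)$ with a lattice norm and contain $\chi_\Omega$). Generalized Orlicz spaces. For such a space $X$ over $\mu$: $\widetilde{X}^{\Phi}:=\{f\in L^0(\mu):\Phi(|f|)\in X\}$, $X^{\Phi}:=\{f\in L^0(\mu):\exists\,c>0,\ |f|/c\in\widetilde{X}^{\Phi}\}$, and $\|f\|_{X^{\Phi}}:=\inf\{k>0:|f|/k\in\widetilde{X}^{\Phi},\ \|\Phi(|f|/k)\|_X\le1\}$. For a positive finite measure $\nu$, $L^{\Phi}(\nu)$ is the classical Orlicz space with Luxemburg norm, i.e. $L^{\Phi}(\nu)=L^1(\nu)^{\Phi}$. Define $L^{\Phi}_w(m):=\{f\in L^0(m):f\in L^{\Phi}(|\langle m,y^*\rangle|)\ \forall y^*\in Y^*\}$ with norm $\|f\|_{L^{\Phi}_w(m)}:=\sup\{\|f\|_{L^{\Phi}(|\langle m,y^*\rangle|)}:y^*\in B_{Y^*}\}$, and $L^{\Phi}(m)$ is the closure in $L^{\Phi}_w(m)$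 of the space of $\Sigma$-simple functions. *)

theory Defs
  imports "HOL-Analysis.Analysis"
begin

text \<open>
  Conventions.  A value \<open>M :: 'a measure\<close> that accompanies a vector measure only serves as the
  measurable space \<open>(space M, sets M)\<close>; its own \<open>emeasure\<close> is never used.  As usual in
  HOL-Analysis, function spaces are sets of measurable functions rather than of
  almost-everywhere classes: all the spaces below are saturated with respect to equality
  outside an \<open>m\<close>-null set and all the norms below are invariant under it, so equalities and
  inclusions between the sets of representatives are the same as those between the sets of
  classes.  In particular \<open>borel_measurable M\<close> plays the role of the space \<open>L\<^sup>0\<close> of \<open>m\<close>
  (equivalently, of any Rybakov control measure of \<open>m\<close>).  Norms take values in \<^typ>\<open>ennreal\<close>, so
  suprema and infima are meaningful without any a priori boundedness.
\<close>

definition young_function :: "(real \<Rightarrow> real) \<Rightarrow> bool" where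
  "young_function \<Phi> \<longleftrightarrow>
     \<Phi> ` {0..} \<subseteq> {0..} \<and> strict_mono_on {0..} \<Phi> \<and> continuous_on {0..} \<Phi> \<and>
     convex_on {0..} \<Phi> \<and> \<Phi> 0 = 0 \<and> filterlim \<Phi> at_top at_top"

definition Delta2 :: "(real \<Rightarrow> real) \<Rightarrow> bool" where
  "Delta2 \<Phi> \<longleftrightarrow> (\<exists>C>1. \<forall>t\<ge>0. \<Phi> (2 * t) \<le> C * \<Phi> t)"

definition vector_measure :: "'a measure \<Rightarrow> ('a set \<Rightarrow> 'b::real_normed_vector) \<Rightarrow> bool" where
  "vector_measure M m \<longleftrightarrow>
     (\<forall>A. range A \<subseteq> sets M \<longrightarrow> disjoint_family A \<longrightarrow> (\<lambda>i::nat. m (A i)) sums m (\<Union>i. A i))"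

definition variation :: "'a measure \<Rightarrow> ('a set \<Rightarrow> real) \<Rightarrow> 'a set \<Rightarrow> ennreal" where
  "variation M \<nu> A =
     (SUP P\<in>{P. finite P \<and> P \<subseteq> sets M \<and> partition_on A P}. \<Sum>B\<in>P. ennreal \<bar>\<nu> B\<bar>)"

text \<open>
  \<^const>\<open>measure_of\<close> yields the measure with the given values, since \<^const>\<open>variation\<close> is
  countably additive on \<open>sets M\<close> whenever \<open>\<nu>\<close> is.
\<close>

definition variation_measure :: "'a measure \<Rightarrow> ('a set \<Rightarrow> real) \<Rightarrow> 'a measure" where
  "variation_measure M \<nu> = measure_of (space M) (sets M) (variation M \<nu>)"

text \<open>
  The positive part of the Jordan decomposition of a signed measure \<open>\<nu>\<close>; the negative part is the
  positive part of \<open>-\<nu>\<close>.  Here \<^const>\<open>ennreal\<close> truncates negative values to \<open>0 = \<nu> {}\<close>, which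
  does not affect the supremum.
\<close>

definition positive_part_measure :: "'a measure \<Rightarrow> ('a set \<Rightarrow> real) \<Rightarrow> 'a measure" where
  "positive_part_measure M \<nu> =
     measure_of (space M) (sets M) (\<lambda>A. SUP B\<in>{B \<in> sets M. B \<subseteq> A}. ennreal (\<nu> B))"

definition signed_set_integral ::
    "'a measure \<Rightarrow> ('a set \<Rightarrow> real) \<Rightarrow> 'a set \<Rightarrow> ('a \<Rightarrow> real) \<Rightarrow> real" where
  "signed_set_integral M \<nu> A f =
     set_lebesgue_integral (positive_part_measure M \<nu>) A f
     - set_lebesgue_integral (positive_part_measure M (\<lambda>B. - \<nu> B)) A f"

definition scalarization ::
    "('a set \<Rightarrow> 'b::real_normed_vector) \<Rightarrow> ('b \<Rightarrow>\<^sub>L real) \<Rightarrow> 'a set \<Rightarrow> real" where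
  "scalarization m y A = blinfun_apply y (m A)"

abbreviation scalar_variation ::
    "'a measure \<Rightarrow> ('a set \<Rightarrow> 'b::real_normed_vector) \<Rightarrow> ('b \<Rightarrow>\<^sub>L real) \<Rightarrow> 'a measure" where
  "scalar_variation M m y \<equiv> variation_measure M (scalarization m y)"

definition L1w :: "'a measure \<Rightarrow> ('a set \<Rightarrow> 'b::real_normed_vector) \<Rightarrow> ('a \<Rightarrow> real) set" where
  "L1w M m = {f \<in> borel_measurable M. \<forall>y. integrable (scalar_variation M m y) f}"

definition L1 :: "'a measure \<Rightarrow> ('a set \<Rightarrow> 'b::real_normed_vector) \<Rightarrow> ('a \<Rightarrow> real) set" where
  "L1 M m = {f \<in> L1w M m. \<forall>A\<in>sets M. \<exists>z. \<forall>y.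
               blinfun_apply y z = signed_set_integral M (scalarization m y) A f}"

definition L1w_norm ::
    "'a measure \<Rightarrow> ('a set \<Rightarrow> 'b::real_normed_vector) \<Rightarrow> ('a \<Rightarrow> real) \<Rightarrow> ennreal" where
  "L1w_norm M m f = (SUP y\<in>cball 0 1. \<integral>\<^sup>+x. ennreal \<bar>f x\<bar> \<partial>scalar_variation M m y)"

text \<open>
  \<open>X\<close> is the carrier and \<open>N\<close> the norm of a Banach function space over the measurable space \<open>M\<close>.
\<close>

definition orlicz_class ::
    "(real \<Rightarrow> real) \<Rightarrow> 'a measure \<Rightarrow> ('a \<Rightarrow> real) set \<Rightarrow> ('a \<Rightarrow> real) set" where
  "orlicz_class \<Phi> M X = {f \<in> borel_measurable M. (\<lambda>x. \<Phi> \<bar>f x\<bar>) \<in> X}"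

definition orlicz_space ::
    "(real \<Rightarrow> real) \<Rightarrow> 'a measure \<Rightarrow> ('a \<Rightarrow> real) set \<Rightarrow> ('a \<Rightarrow> real) set" where
  "orlicz_space \<Phi> M X =
     {f \<in> borel_measurable M. \<exists>c>0. (\<lambda>x. \<bar>f x\<bar> / c) \<in> orlicz_class \<Phi> M X}"

definition orlicz_norm ::
    "(real \<Rightarrow> real) \<Rightarrow> 'a measure \<Rightarrow> ('a \<Rightarrow> real) set \<Rightarrow> (('a \<Rightarrow> real) \<Rightarrow> ennreal) \<Rightarrow>
     ('a \<Rightarrow> real) \<Rightarrow> ennreal" where
  "orlicz_norm \<Phi> M X N f =
     (INF k\<in>{k. k > 0 \<and> (\<lambda>x. \<bar>f x\<bar> / k) \<in> orlicz_class \<Phi> M X \<and>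
                N (\<lambda>x. \<Phi> (\<bar>f x\<bar> / k)) \<le> 1}. ennreal k)"

definition LPhi_classical :: "(real \<Rightarrow> real) \<Rightarrow> 'a measure \<Rightarrow> ('a \<Rightarrow> real) set" where
  "LPhi_classical \<Phi> \<nu> = orlicz_space \<Phi> \<nu> {f. integrable \<nu> f}"

definition luxemburg_norm :: "(real \<Rightarrow> real) \<Rightarrow> 'a measure \<Rightarrow> ('a \<Rightarrow> real) \<Rightarrow> ennreal" where
  "luxemburg_norm \<Phi> \<nu> =
     orlicz_norm \<Phi> \<nu> {f. integrable \<nu> f} (\<lambda>f. \<integral>\<^sup>+x. ennreal \<bar>f x\<bar> \<partial>\<nu>)"

definition LPhi_w ::
    "(real \<Rightarrow> real) \<Rightarrow> 'a measure \<Rightarrow> ('a set \<Rightarrow> 'b::real_normed_vector) \<Rightarrow> ('a \<Rightarrow> real) set" where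
  "LPhi_w \<Phi> M m =
     {f \<in> borel_measurable M. \<forall>y. f \<in> LPhi_classical \<Phi> (scalar_variation M m y)}"

definition LPhi_w_norm ::
    "(real \<Rightarrow> real) \<Rightarrow> 'a measure \<Rightarrow> ('a set \<Rightarrow> 'b::real_normed_vector) \<Rightarrow> ('a \<Rightarrow> real) \<Rightarrow> ennreal" where
  "LPhi_w_norm \<Phi> M m f = (SUP y\<in>cball 0 1. luxemburg_norm \<Phi> (scalar_variation M m y) f)"

definition LPhi ::
    "(real \<Rightarrow> real) \<Rightarrow> 'a measure \<Rightarrow> ('a set \<Rightarrow> 'b::real_normed_vector) \<Rightarrow> ('a \<Rightarrow> real) set" where
  "LPhi \<Phi> M m =
     {f \<in> LPhi_w \<Phi> M m. \<forall>e>0. \<exists>s. simple_function M s \<and>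
        LPhi_w_norm \<Phi> M m (\<lambda>x. f x - s x) < ennreal e}"

end

theory Submission
  imports Defs
begin

text \<open>
  Each scalarization \<open>y \<circ> m\<close> has a polar decomposition \<open>\<sigma> \<sqdot> \<bar>y \<circ> m\<bar>\<close>, so that
  \<open>\<integral> \<bar>u\<bar> d\<bar>y \<circ> m\<bar>\<close> is the supremum of \<open>\<bar>y z\<bar>\<close> over a set of vectors \<open>z\<close> not depending on
  \<open>y\<close>, namely the integrals of simple functions dominated by \<open>\<bar>u\<bar>\<close>.  The Baire category theorem
  in the dual space therefore turns a scaling constant for \<open>\<Phi>(\<bar>f\<bar> / c)\<close> depending on \<open>y\<close> into a
  uniform one, which gives (i).  For (ii), norm limits of simple functions are integrable, and
  integrable functions have order continuous norm by the Orlicz-Pettis theorem; the first fact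
  applies to truncations of \<open>\<Phi>(\<bar>f\<bar>)\<close>, the second makes the tails of \<open>\<Phi>(\<bar>f\<bar> / c)\<close> small, and
  \<open>\<Delta>\<^sub>2\<close> absorbs the scaling constant.
\<close>

section \<open>Hahn and polar decomposition of signed measures\<close>

text \<open>The obstacle in (i) is that \<open>y\<close> enters twice, through the scaling constant
  and through the size of the integral, while the variation is not linear in \<open>y\<close>.
  Letting a single integer \<open>n\<close> bound both quantities covers the dual space by countably
  many closed sets, one for each rescaled function \<open>\<Phi>(\<bar>f\<bar> / (n + 1))\<close>; a
  ball inside one of them fixes the scale for all \<open>y\<close>. In (ii) the norm of
  \<open>L1w\<close> need not be order continuous, so tails cannot simply be cut off there. The
  existence of vector integrals over all measurable sets is what permits it in \<open>L1\<close>: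
  tails that do not vanish would produce a weakly subseries convergent series whose terms stay away
  from zero. Both inclusions then rest on a splitting along \<open>{\<bar>f\<bar> > n}\<close>: off
  this set everything is bounded and the semivariation of the space is finite, while on it a
  convexity or doubling estimate meets a small tail.\<close>

lemma vector_measure_empty:
  assumes "vector_measure M m"
  shows "m {} = 0"
proof -
  have "(\<lambda>i::nat. m {}) sums m (\<Union>i::nat. {})"
    using assms unfolding vector_measure_def disjoint_family_on_def
    by (auto dest: spec[of _ "\<lambda>_. {}"])
  then have "(\<lambda>i::nat. m {}) \<longlonglongrightarrow> 0"
    by (intro summable_LIMSEQ_zero) (simp add: sums_iff)
  then show ?thesis by (simp add: LIMSEQ_const_iff)
qed

lemma vector_measure_sums:
  assumes "vector_measure M m" "\<And>i::nat. A i \<in> sets M" "disjoint_family A"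
  shows "(\<lambda>i. m (A i)) sums m (\<Union>i. A i)"
  using assms unfolding vector_measure_def by blast

lemma vector_measure_Un:
  assumes vm: "vector_measure M m" and "A \<in> sets M" "B \<in> sets M" "A \<inter> B = {}"
  shows "m (A \<union> B) = m A + m B"
proof -
  have "(\<lambda>i. m (binaryset A B i)) sums m (\<Union>i. binaryset A B i)"
    using assms by (intro vector_measure_sums[OF vm])
      (auto simp: binaryset_def disjoint_family_on_def)
  moreover have "(\<lambda>i. m (binaryset A B i)) sums (m A + m B)"
    by (rule binaryset_sums) (rule vector_measure_empty[OF vm])
  ultimately show ?thesis by (metis sums_unique2 UN_binaryset_eq)
qed

lemma vector_measure_Diff:
  assumes vm: "vector_measure M m" and "A \<in> sets M" "B \<in> sets M" "B \<subseteq> A"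
  shows "m (A - B) = m A - m B"
proof -
  have "m ((A - B) \<union> B) = m (A - B) + m B"
    by (rule vector_measure_Un[OF vm]) (use assms in auto)
  moreover have "(A - B) \<union> B = A" using assms by auto
  ultimately show ?thesis by (simp add: algebra_simps)
qed

lemma vector_measure_Int_Diff_split:
  assumes vm: "vector_measure M m" and "A \<in> sets M" "H \<in> sets M"
  shows "m A = m (A \<inter> H) + m (A - H)"
proof -
  have "m ((A \<inter> H) \<union> (A - H)) = m (A \<inter> H) + m (A - H)"
    by (rule vector_measure_Un[OF vm]) (use assms in auto)
  then show ?thesis by (simp add: Int_Diff_Un)
qed

lemma vector_measure_Union:
  assumes vm: "vector_measure M m" and "finite P" "P \<subseteq> sets M" "disjoint P"
  shows "m (\<Union>P) = (\<Sum>B\<in>P. m B)"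
  using assms(2-4)
proof (induction P rule: finite_induct)
  case empty
  then show ?case by (simp add: vector_measure_empty[OF vm])
next
  case (insert B P)
  have "m (B \<union> \<Union>P) = m B + m (\<Union>P)"
    using insert.hyps insert.prems
    by (intro vector_measure_Un[OF vm]) (auto simp: disjoint_def)
  then show ?case using insert by (simp add: pairwise_insert disjoint_def)
qed

lemma vector_measure_uminus:
  "vector_measure M (\<nu> :: 'a set \<Rightarrow> real) \<Longrightarrow> vector_measure M (\<lambda>A. - \<nu> A)"
  unfolding vector_measure_def by (auto intro: sums_minus)

lemma vector_measure_scalarization:
  "vector_measure M m \<Longrightarrow> vector_measure M (scalarization m y)"
  unfolding vector_measure_def scalarization_def
  by (auto intro: bounded_linear.sums blinfun.bounded_linear_right)

text \<open>Greedy selection: each step removes from what remains a member of \<open>F\<close> whose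
  value is at least half of any value still available, capped at 1. The removed sets are disjoint,
  so their values are summable and tend to 0; hence no positive value survives in \<open>F\<close>.
  An abstract \<open>F\<close> allows one use with all measurable sets and \<open>- \<nu>\<close>,
  and one with the positive sets and \<open>\<nu>\<close>.\<close>

lemma exhaustion:
  fixes \<nu> :: "'a set \<Rightarrow> real"
  assumes vm: "vector_measure M \<nu>" and F: "F \<subseteq> sets M" "{} \<in> F"
  obtains C :: "nat \<Rightarrow> 'a set" where "\<And>n. C n \<in> F" "\<And>n. C n \<subseteq> D" "disjoint_family C"
    "\<And>n. 0 \<le> \<nu> (C n)" "\<And>E. E \<in> F \<Longrightarrow> E \<subseteq> D - (\<Union>n. C n) \<Longrightarrow> \<nu> E \<le> 0"
proof -
  \<comment> \<open>The cap 1 covers unbounded available values; the factor 1/2 leaves room below a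
    supremum that need not be attained.\<close>
  define good where "good X C \<longleftrightarrow> C \<in> F \<and> C \<subseteq> X \<and> 0 \<le> \<nu> C \<and>
    (\<forall>E\<in>F. E \<subseteq> X \<longrightarrow> min (\<nu> E / 2) 1 \<le> \<nu> C)" for X C
  have ex: "\<exists>C. good X C" for X
  proof (cases "\<exists>E\<in>F. E \<subseteq> X \<and> 1 \<le> \<nu> E")
    case True
    then show ?thesis unfolding good_def by (force simp: min_def)
  next
    case False
    define s where "s = Sup (\<nu> ` {E\<in>F. E \<subseteq> X})"
    have bdd: "bdd_above (\<nu> ` {E\<in>F. E \<subseteq> X})"
      using False by (intro bdd_aboveI[of _ 1]) force
    have le: "\<nu> E \<le> s" if "E \<in> F" "E \<subseteq> X" for E
      unfolding s_def using that bdd by (auto intro: cSup_upper)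
    have s0: "0 \<le> s" using le[of "{}"] F vector_measure_empty[OF vm] by auto
    show ?thesis
    proof (cases "s = 0")
      case True
      then have "good X {}"
        unfolding good_def using F vector_measure_empty[OF vm] le by (fastforce simp: min_def)
      then show ?thesis by blast
    next
      case False
      then have "s / 2 < Sup (\<nu> ` {E\<in>F. E \<subseteq> X})" using s0 s_def by linarith
      then obtain C where C: "C \<in> F" "C \<subseteq> X" "s / 2 < \<nu> C"
        using F by (subst (asm) less_cSup_iff[OF _ bdd]) auto
      have "min (\<nu> E / 2) 1 \<le> \<nu> C" if "E \<in> F" "E \<subseteq> X" for E
        using le[OF that] C by (auto simp: min_def)
      then have "good X C" unfolding good_def using C s0 by auto
      then show ?thesis by blast
    qed
  qed
  define pick where "pick X = (SOME C. good X C)" for X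
  have pick: "good X (pick X)" for X unfolding pick_def by (rule someI_ex[OF ex])
  define R where "R n = ((\<lambda>X. X - pick X) ^^ n) D" for n :: nat
  define C where "C n = pick (R n)" for n
  have R0: "R 0 = D" and RS: "R (Suc n) = R n - C n" for n
    by (simp_all add: R_def C_def)
  have gC: "good (R n) (C n)" for n unfolding C_def by (rule pick)
  have Req: "R n = D - (\<Union>k<n. C k)" for n
    by (induction n) (auto simp: R0 RS lessThan_Suc)
  have CR: "C n \<subseteq> D - (\<Union>k<n. C k)" for n using gC[of n] Req unfolding good_def by auto
  have disj: "disjoint_family C"
    unfolding disjoint_family_on_def
  proof (intro ballI impI)
    fix i j :: nat assume "i \<noteq> j"
    then show "C i \<inter> C j = {}" using CR[of i] CR[of j] by (cases "i < j") (auto simp: not_less)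
  qed
  have CF: "C n \<in> F" for n using gC[of n] unfolding good_def by auto
  have "summable (\<lambda>n. \<nu> (C n))"
    using vector_measure_sums[OF vm _ disj] CF F by (auto simp: sums_iff)
  then have lim: "(\<lambda>n. \<nu> (C n)) \<longlonglongrightarrow> 0" by (rule summable_LIMSEQ_zero)
  have "\<nu> E \<le> 0" if E: "E \<in> F" "E \<subseteq> D - (\<Union>n. C n)" for E
  proof -
    have "min (\<nu> E / 2) 1 \<le> \<nu> (C n)" for n
    proof -
      have "E \<subseteq> R n" using E(2) unfolding Req by blast
      then show ?thesis using gC[of n] E(1) unfolding good_def by blast
    qed
    then have "min (\<nu> E / 2) 1 \<le> 0" using lim by (meson LIMSEQ_le_const)
    then show ?thesis by (auto simp: min_def split: if_splits)
  qed
  then show ?thesis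
    using CF CR disj gC by (intro that[of C]) (auto simp: good_def)
qed

text \<open>Exhausting \<open>A\<close> with respect to \<open>- \<nu>\<close> removes disjoint
  pieces of total value at most 0, so the remainder has value at least \<open>\<nu> A\<close> and
  contains no set of negative value.\<close>

lemma exists_positive_subset:
  fixes \<nu> :: "'a set \<Rightarrow> real"
  assumes vm: "vector_measure M \<nu>" and A: "A \<in> sets M"
  obtains B where "B \<in> sets M" "B \<subseteq> A" "\<nu> A \<le> \<nu> B"
    "\<And>E. E \<in> sets M \<Longrightarrow> E \<subseteq> B \<Longrightarrow> 0 \<le> \<nu> E"
proof -
  obtain C :: "nat \<Rightarrow> 'a set" where C: "\<And>n. C n \<in> sets M" "\<And>n. C n \<subseteq> A" "disjoint_family C"
    "\<And>n. 0 \<le> - \<nu> (C n)" "\<And>E. E \<in> sets M \<Longrightarrow> E \<subseteq> A - (\<Union>n. C n) \<Longrightarrow> - \<nu> E \<le> 0"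
    using exhaustion[OF vector_measure_uminus[OF vm], of "sets M" A] by auto
  have U: "(\<Union>n. C n) \<in> sets M" using C by auto
  have sums: "(\<lambda>n. \<nu> (C n)) sums \<nu> (\<Union>n. C n)" by (rule vector_measure_sums[OF vm C(1,3)])
  have "\<nu> (\<Union>n. C n) \<le> 0" by (rule sums_le[OF _ sums sums_zero]) (use C(4) in simp)
  moreover have "\<nu> (A - (\<Union>n. C n)) = \<nu> A - \<nu> (\<Union>n. C n)"
    using C U A by (intro vector_measure_Diff[OF vm]) auto
  ultimately show ?thesis
    using that[of "A - (\<Union>n. C n)"] C(5) U A by auto
qed

text \<open>The space is exhausted by positive sets, those without measurable subsets of negative
  value. A set of positive value outside their union would contain a positive set of positive value
  by \<open>exists_positive_subset\<close>, contradicting the exhaustion.\<close>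

theorem Hahn_decomposition:
  fixes \<nu> :: "'a set \<Rightarrow> real"
  assumes vm: "vector_measure M \<nu>"
  obtains H where "H \<in> sets M" "\<And>A. A \<in> sets M \<Longrightarrow> A \<subseteq> H \<Longrightarrow> 0 \<le> \<nu> A"
    "\<And>A. A \<in> sets M \<Longrightarrow> A \<inter> H = {} \<Longrightarrow> \<nu> A \<le> 0"
proof -
  define F where "F = {B \<in> sets M. \<forall>E\<in>sets M. E \<subseteq> B \<longrightarrow> 0 \<le> \<nu> E}"
  have "F \<subseteq> sets M" "{} \<in> F"
    using vector_measure_empty[OF vm] by (auto simp: F_def)
  then obtain C :: "nat \<Rightarrow> 'a set" where C: "\<And>n. C n \<in> F" "disjoint_family C"
    "\<And>E. E \<in> F \<Longrightarrow> E \<subseteq> space M - (\<Union>n. C n) \<Longrightarrow> \<nu> E \<le> 0"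
    using exhaustion[OF vm, of F "space M"] by metis
  have CM: "C n \<in> sets M" for n using C(1) by (auto simp: F_def)
  show ?thesis
  proof (rule that)
    show U: "(\<Union>n. C n) \<in> sets M" using CM by auto
    show "0 \<le> \<nu> A" if A: "A \<in> sets M" "A \<subseteq> (\<Union>n. C n)" for A
    proof -
      have "disjoint_family (\<lambda>n. A \<inter> C n)"
        using C(2) by (auto simp: disjoint_family_on_def)
      then have "(\<lambda>n. \<nu> (A \<inter> C n)) sums \<nu> (\<Union>n. A \<inter> C n)"
        using A CM by (intro vector_measure_sums[OF vm]) auto
      moreover have "(\<Union>n. A \<inter> C n) = A" using A by auto
      moreover have "0 \<le> \<nu> (A \<inter> C n)" for n using C(1)[of n] A by (auto simp: F_def)
      ultimately show ?thesis by (metis sums_le[OF _ sums_zero])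
    qed
    show "\<nu> A \<le> 0" if A: "A \<in> sets M" "A \<inter> (\<Union>n. C n) = {}" for A
    proof -
      obtain B where B: "B \<in> sets M" "B \<subseteq> A" "\<nu> A \<le> \<nu> B"
        "\<And>E. E \<in> sets M \<Longrightarrow> E \<subseteq> B \<Longrightarrow> 0 \<le> \<nu> E"
        using exists_positive_subset[OF vm A(1)] by blast
      have "B \<in> F" using B by (auto simp: F_def)
      moreover have "B \<subseteq> space M - (\<Union>n. C n)"
        using A(2) B(2) sets.sets_into_space[OF B(1)] by blast
      ultimately show ?thesis using C(3)[of B] B(3) by linarith
    qed
  qed
qed

section \<open>Variation and Jordan parts in terms of a Hahn set\<close>

lemma sets_variation_measure [simp, measurable_cong]: "sets (variation_measure M \<nu>) = sets M"
  and space_variation_measure [simp]: "space (variation_measure M \<nu>) = space M"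
  by (simp_all add: variation_measure_def)

lemma measurable_variation_measure [simp]:
  "measurable (variation_measure M \<nu>) N = measurable M N"
  by (rule measurable_cong_sets) simp_all

lemma simple_function_variation_measure [simp]:
  "simple_function (variation_measure M \<nu>) f \<longleftrightarrow> simple_function M f"
  by (simp add: simple_function_def)

text \<open>\<open>measure_of\<close> keeps the prescribed values only if they are positive and
  countably additive. Both properties are inherited from the nonnegative real \<open>g\<close>,
  whose convergent series are also series in \<open>ennreal\<close>.\<close>

lemma emeasure_measure_of_sums:
  fixes g :: "'a set \<Rightarrow> real"
  assumes "\<And>A. A \<in> sets M \<Longrightarrow> \<mu> A = ennreal (g A)" and "\<And>A. A \<in> sets M \<Longrightarrow> 0 \<le> g A"
    and "vector_measure M g" and A: "A \<in> sets M"
  shows "emeasure (measure_of (space M) (sets M) \<mu>) A = ennreal (g A)"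
proof -
  have "positive (sets M) \<mu>"
    using assms(1)[of "{}"] vector_measure_empty[OF assms(3)] by (simp add: positive_def)
  moreover have "countably_additive (sets M) \<mu>"
  proof (rule countably_additiveI)
    fix B :: "nat \<Rightarrow> 'a set"
    assume B: "range B \<subseteq> sets M" "disjoint_family B"
    have "(\<lambda>i. g (B i)) sums g (\<Union>i. B i)"
      using B by (intro vector_measure_sums[OF assms(3)]) auto
    moreover have "0 \<le> g (B i)" for i using B assms(2) by auto
    ultimately have "(\<Sum>i. ennreal (g (B i))) = ennreal (g (\<Union>i. B i))"
      by (intro suminf_ennreal_eq)
    then show "(\<Sum>i. \<mu> (B i)) = \<mu> (\<Union>i. B i)" using B assms(1) by (simp add: image_subset_iff)
  qed
  ultimately show ?thesis
    using A assms(1) emeasure_measure_of_sigma[OF sets.sigma_algebra_axioms[of M]] by simp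
qed

context
  fixes M :: "'a measure" and \<nu> :: "'a set \<Rightarrow> real" and H
  assumes vm: "vector_measure M \<nu>" and H: "H \<in> sets M"
    and pos: "\<And>A. A \<in> sets M \<Longrightarrow> A \<subseteq> H \<Longrightarrow> 0 \<le> \<nu> A"
    and neg: "\<And>A. A \<in> sets M \<Longrightarrow> A \<inter> H = {} \<Longrightarrow> \<nu> A \<le> 0"
begin

lemma vector_measure_Int_Diff: "vector_measure M (\<lambda>A. \<nu> (A \<inter> H) - \<nu> (A - H))"
  and vector_measure_Int: "vector_measure M (\<lambda>A. \<nu> (A \<inter> H))"
proof -
  have 1: "(\<lambda>i. \<nu> (A i \<inter> H)) sums \<nu> ((\<Union>i. A i) \<inter> H)"
    and 2: "(\<lambda>i. \<nu> (A i - H)) sums \<nu> ((\<Union>i. A i) - H)"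
    if A: "range A \<subseteq> sets M" "disjoint_family A" for A :: "nat \<Rightarrow> 'a set"
  proof -
    have "(\<lambda>i. \<nu> (A i \<inter> H)) sums \<nu> (\<Union>i. A i \<inter> H)"
      using A H by (intro vector_measure_sums[OF vm]) (auto simp: disjoint_family_on_def)
    then show "(\<lambda>i. \<nu> (A i \<inter> H)) sums \<nu> ((\<Union>i. A i) \<inter> H)" by simp
    have "(\<lambda>i. \<nu> (A i - H)) sums \<nu> (\<Union>i. A i - H)"
      using A H by (intro vector_measure_sums[OF vm]) (auto simp: disjoint_family_on_def)
    then show "(\<lambda>i. \<nu> (A i - H)) sums \<nu> ((\<Union>i. A i) - H)" by simp
  qed
  show "vector_measure M (\<lambda>A. \<nu> (A \<inter> H) - \<nu> (A - H))" "vector_measure M (\<lambda>A. \<nu> (A \<inter> H))"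
    unfolding vector_measure_def by (auto intro: sums_diff 1 2)
qed

text \<open>The cells \<open>A \<inter> H\<close> and \<open>A - H\<close> attain the supremum: the
  additive function \<open>\<nu> (B \<inter> H) - \<nu> (B - H)\<close> dominates
  \<open>\<bar>\<nu> B\<bar>\<close>, so no partition of \<open>A\<close> gives more.\<close>

lemma variation_eq:
  assumes A: "A \<in> sets M"
  shows "variation M \<nu> A = ennreal (\<nu> (A \<inter> H) - \<nu> (A - H))"
proof (rule antisym)
  define g where "g = (\<lambda>A. \<nu> (A \<inter> H) - \<nu> (A - H))"
  have g: "\<bar>\<nu> B\<bar> \<le> g B" if "B \<in> sets M" for B
    using vector_measure_Int_Diff_split[OF vm that H] pos[of "B \<inter> H"] neg[of "B - H"] that H
    by (force simp: g_def abs_le_iff)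
  show "variation M \<nu> A \<le> ennreal (\<nu> (A \<inter> H) - \<nu> (A - H))"
    unfolding variation_def
  proof (rule SUP_least, clarify)
    fix P assume P: "finite P" "P \<subseteq> sets M" "partition_on A P"
    have "(\<Sum>B\<in>P. ennreal \<bar>\<nu> B\<bar>) = ennreal (\<Sum>B\<in>P. \<bar>\<nu> B\<bar>)" by (rule sum_ennreal) simp
    also have "\<dots> \<le> ennreal (\<Sum>B\<in>P. g B)" using g P by (intro ennreal_leI sum_mono) auto
    also have "(\<Sum>B\<in>P. g B) = g (\<Union>P)"
      using vector_measure_Union[OF vector_measure_Int_Diff P(1,2)] partition_onD2[OF P(3)]
      by (simp add: g_def)
    also have "\<Union>P = A" using P(3) by (auto simp: partition_on_def)
    finally show "(\<Sum>B\<in>P. ennreal \<bar>\<nu> B\<bar>) \<le> ennreal (\<nu> (A \<inter> H) - \<nu> (A - H))" by (simp add: g_def)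
  qed
  \<comment> \<open>Cells of a partition are nonempty, so an empty half is dropped; its term is
    0.\<close>
  define P where "P = {A \<inter> H, A - H} - {{}}"
  have P: "finite P \<and> P \<subseteq> sets M \<and> partition_on A P"
    using A H by (auto simp: P_def partition_on_def disjoint_def)
  have "(\<Sum>B\<in>P. ennreal \<bar>\<nu> B\<bar>) = (\<Sum>B\<in>{A \<inter> H, A - H}. ennreal \<bar>\<nu> B\<bar>)"
    unfolding P_def by (rule sum.mono_neutral_left) (auto simp: vector_measure_empty[OF vm])
  also have "\<dots> = ennreal \<bar>\<nu> (A \<inter> H)\<bar> + ennreal \<bar>\<nu> (A - H)\<bar>"
  proof (cases "A \<inter> H = A - H")
    case True
    then have *: "A \<inter> H = {}" "A - H = {}" by auto
    show ?thesis unfolding * by (simp add: vector_measure_empty[OF vm])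
  qed simp
  also have "\<dots> = ennreal (\<nu> (A \<inter> H) - \<nu> (A - H))"
  proof -
    have "0 \<le> \<nu> (A \<inter> H)" "\<nu> (A - H) \<le> 0" using pos[of "A \<inter> H"] neg[of "A - H"] A H by auto
    then show ?thesis by (simp flip: ennreal_plus)
  qed
  finally show "ennreal (\<nu> (A \<inter> H) - \<nu> (A - H)) \<le> variation M \<nu> A"
    unfolding variation_def using P by (intro SUP_upper2[of P]) auto
qed

lemma emeasure_variation_measure:
  assumes A: "A \<in> sets M"
  shows "emeasure (variation_measure M \<nu>) A = ennreal (\<nu> (A \<inter> H) - \<nu> (A - H))"
  unfolding variation_measure_def
proof (rule emeasure_measure_of_sums[OF _ _ vector_measure_Int_Diff A])
  show "0 \<le> \<nu> (A \<inter> H) - \<nu> (A - H)" if "A \<in> sets M" for A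
    using pos[of "A \<inter> H"] neg[of "A - H"] that H by force
qed (rule variation_eq)

text \<open>Replacing \<open>B\<close> by \<open>B \<inter> H\<close> discards a nonpositive value
  and enlarging it to \<open>A \<inter> H\<close> adds a nonnegative one, so the supremum is
  attained at \<open>A \<inter> H\<close>. The density form places both Jordan parts over the
  variation, which merges the two integrals of \<open>signed_set_integral\<close> into one.\<close>

lemma positive_part_measure_eq:
  "positive_part_measure M \<nu> = density (variation_measure M \<nu>) (\<lambda>x. ennreal (indicator H x))"
proof (rule measure_eqI)
  show "sets (positive_part_measure M \<nu>) =
      sets (density (variation_measure M \<nu>) (\<lambda>x. ennreal (indicator H x)))"
    by (simp add: positive_part_measure_def)
  fix A assume "A \<in> sets (positive_part_measure M \<nu>)"
  then have A: "A \<in> sets M" by (simp add: positive_part_measure_def)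
  have "emeasure (positive_part_measure M \<nu>) A = ennreal (\<nu> (A \<inter> H))"
    unfolding positive_part_measure_def
  proof (rule emeasure_measure_of_sums[OF _ _ vector_measure_Int A])
    fix A assume A: "A \<in> sets M"
    show "0 \<le> \<nu> (A \<inter> H)" using pos A H by auto
    have "\<nu> B \<le> \<nu> (A \<inter> H)" if B: "B \<in> sets M" "B \<subseteq> A" for B
    proof -
      have "\<nu> ((A \<inter> H) - (B \<inter> H)) = \<nu> (A \<inter> H) - \<nu> (B \<inter> H)"
        using A B H by (intro vector_measure_Diff[OF vm]) auto
      moreover have "0 \<le> \<nu> ((A \<inter> H) - (B \<inter> H))" using A B H by (intro pos) auto
      moreover have "\<nu> (B - H) \<le> 0" using B H by (intro neg) auto
      ultimately show ?thesis using vector_measure_Int_Diff_split[OF vm B(1) H] by linarith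
    qed
    then show "(SUP B\<in>{B \<in> sets M. B \<subseteq> A}. ennreal (\<nu> B)) = ennreal (\<nu> (A \<inter> H))"
      using A H by (intro antisym SUP_least) (auto intro!: SUP_upper2[of "A \<inter> H"] ennreal_leI)
  qed
  also have "\<dots> = emeasure (variation_measure M \<nu>) (A \<inter> H)"
  proof -
    have "(A \<inter> H) \<inter> H = A \<inter> H" "A \<inter> H - H = {}" by auto
    then show ?thesis
      using A H emeasure_variation_measure[of "A \<inter> H"] vector_measure_empty[OF vm]
      by (simp only: sets.Int) simp
  qed
  also have "\<dots> = emeasure (density (variation_measure M \<nu>) (\<lambda>x. ennreal (indicator H x))) A"
  proof -
    have "emeasure (density (variation_measure M \<nu>) (\<lambda>x. ennreal (indicator H x))) A =
        (\<integral>\<^sup>+x. ennreal (indicator H x) * indicator A x \<partial>variation_measure M \<nu>)"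
      using A H by (intro emeasure_density) simp_all
    also have "\<dots> = (\<integral>\<^sup>+x. indicator (A \<inter> H) x \<partial>variation_measure M \<nu>)"
      by (rule nn_integral_cong) (simp split: split_indicator)
    also have "\<dots> = emeasure (variation_measure M \<nu>) (A \<inter> H)"
      using A H by (intro nn_integral_indicator) simp
    finally show ?thesis by simp
  qed
  finally show "emeasure (positive_part_measure M \<nu>) A =
    emeasure (density (variation_measure M \<nu>) (\<lambda>x. ennreal (indicator H x))) A" .
qed

end

lemma variation_uminus: "variation_measure M (\<lambda>A. - \<nu> A) = variation_measure M \<nu>"
  by (simp add: variation_measure_def variation_def [abs_def])

text \<open>\<open>\<sigma>\<close> is 1 on a Hahn set and -1 off it, the Radon-Nikodym derivative
  of \<open>\<nu>\<close> with respect to its variation. Its square is 1, so multiplying by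
  \<open>\<sigma>\<close> switches between integration against \<open>\<nu>\<close> and against the
  variation.\<close>

theorem polar_decomposition:
  fixes \<nu> :: "'a set \<Rightarrow> real"
  assumes vm: "vector_measure M \<nu>"
  obtains \<sigma> where "\<sigma> \<in> borel_measurable M" "\<And>x. \<sigma> x = 1 \<or> \<sigma> x = -1"
    "\<And>A. A \<in> sets M \<Longrightarrow> \<nu> A = (LINT x|variation_measure M \<nu>. indicator A x * \<sigma> x)"
    "\<And>A f. A \<in> sets M \<Longrightarrow> integrable (variation_measure M \<nu>) f \<Longrightarrow>
       signed_set_integral M \<nu> A f =
         (LINT x|variation_measure M \<nu>. indicator A x * (\<sigma> x * f x))"
    "finite_measure (variation_measure M \<nu>)"
proof -
  let ?V = "variation_measure M \<nu>"
  obtain H where H: "H \<in> sets M" "\<And>A. A \<in> sets M \<Longrightarrow> A \<subseteq> H \<Longrightarrow> 0 \<le> \<nu> A"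
    "\<And>A. A \<in> sets M \<Longrightarrow> A \<inter> H = {} \<Longrightarrow> \<nu> A \<le> 0"
    using Hahn_decomposition[OF vm] by metis
  define K where "K = space M - H"
  have K: "K \<in> sets M" using H by (auto simp: K_def)
  have V: "emeasure ?V A = ennreal (\<nu> (A \<inter> H) - \<nu> (A - H))" if "A \<in> sets M" for A
    by (rule emeasure_variation_measure[OF vm H that])
  have P: "positive_part_measure M \<nu> = density ?V (\<lambda>x. ennreal (indicator H x))"
    by (rule positive_part_measure_eq[OF vm H])
  \<comment> \<open>\<open>- \<nu>\<close> has the same variation and the complement
    \<open>K\<close> as Hahn set, so the negative part follows from the positive one.\<close>
  have N: "positive_part_measure M (\<lambda>A. - \<nu> A) = density ?V (\<lambda>x. ennreal (indicator K x))"
  proof -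
    have 1: "0 \<le> - \<nu> A" if "A \<in> sets M" "A \<subseteq> K" for A
      using H(3)[of A] that by (auto simp: K_def)
    have 2: "- \<nu> A \<le> 0" if "A \<in> sets M" "A \<inter> K = {}" for A
      using H(2)[of A] that sets.sets_into_space[of A M] by (auto simp: K_def)
    have "positive_part_measure M (\<lambda>A. - \<nu> A) =
        density (variation_measure M (\<lambda>A. - \<nu> A)) (\<lambda>x. ennreal (indicator K x))"
      by (rule positive_part_measure_eq[where \<nu> = "\<lambda>A. - \<nu> A" and H = K])
        (fact vector_measure_uminus[OF vm] K 1 2)+
    then show ?thesis by (simp only: variation_uminus)
  qed
  interpret finite_measure ?V
  proof (rule finite_measureI)
    show "emeasure ?V (space ?V) \<noteq> \<infinity>"
      unfolding space_variation_measure V[OF sets.top] by simp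
  qed
  define \<sigma> :: "'a \<Rightarrow> real" where "\<sigma> x = (if x \<in> H then 1 else -1)" for x
  have [measurable]: "\<sigma> \<in> borel_measurable M" "H \<in> sets M" "K \<in> sets M"
    using H(1) K by (simp_all add: \<sigma>_def [abs_def] measurable_If_set)
  show ?thesis
  proof (rule that[of \<sigma>])
    show "\<sigma> \<in> borel_measurable M" by simp
    show "\<sigma> x = 1 \<or> \<sigma> x = -1" for x by (simp add: \<sigma>_def)
    show "finite_measure ?V" by (rule finite_measure_axioms)
  next
    fix A assume A[measurable]: "A \<in> sets M"
    have "(LINT x|?V. indicator A x * \<sigma> x) =
        (LINT x|?V. indicator (A \<inter> H) x - indicator (A - H) x)"
      by (rule Bochner_Integration.integral_cong) (auto simp: \<sigma>_def split: split_indicator)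
    also have "\<dots> = measure ?V (A \<inter> H) - measure ?V (A - H)"
    proof -
      have "A \<inter> H \<in> sets ?V" "A - H \<in> sets ?V" by auto
      then show ?thesis
        by (subst Bochner_Integration.integral_diff)
          (simp_all add: emeasure_eq_measure sets.Int_space_eq2 del: sets_variation_measure)
    qed
    also have "measure ?V (A \<inter> H) = \<nu> (A \<inter> H)"
    proof -
      have *: "A \<inter> H \<inter> H = A \<inter> H" "A \<inter> H - H = {}" by auto
      have AH: "A \<inter> H \<in> sets M" by simp
      then have "0 \<le> \<nu> (A \<inter> H)" by (rule H(2)) simp
      then show ?thesis
        unfolding measure_def V[OF AH] * vector_measure_empty[OF vm] by simp
    qed
    also have "measure ?V (A - H) = - \<nu> (A - H)"
    proof -
      have *: "(A - H) \<inter> H = {}" "A - H - H = A - H" by auto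
      have AH: "A - H \<in> sets M" by simp
      then have "\<nu> (A - H) \<le> 0" by (rule H(3)) auto
      then show ?thesis
        unfolding measure_def V[OF AH] * vector_measure_empty[OF vm] by simp
    qed
    finally show "\<nu> A = (LINT x|?V. indicator A x * \<sigma> x)"
      using vector_measure_Int_Diff_split[OF vm A H(1)] by simp
  next
    fix A and f :: "'a \<Rightarrow> real"
    assume A[measurable]: "A \<in> sets M" and f: "integrable ?V f"
    have [measurable]: "f \<in> borel_measurable M" using f by auto
    have *: "(LINT x:A|density ?V (\<lambda>x. ennreal (indicator B x)). f x) =
        (LINT x|?V. indicator B x * (indicator A x * f x))" if [measurable]: "B \<in> sets M" for B
      unfolding set_lebesgue_integral_def by (subst integral_density) simp_all
    have int: "integrable ?V (\<lambda>x. indicator B x * (indicator A x * f x))" if "B \<in> sets M" for B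
      using integrable_mult_indicator[of B ?V "\<lambda>x. indicator A x * f x"]
        integrable_mult_indicator[of A ?V f] that f A by simp
    have "signed_set_integral M \<nu> A f =
      (LINT x|?V. indicator H x * (indicator A x * f x) - indicator K x * (indicator A x * f x))"
      unfolding signed_set_integral_def P N using int[of H] int[of K] H K by (simp add: *)
    also have "\<dots> = (LINT x|?V. indicator A x * (\<sigma> x * f x))"
      by (rule Bochner_Integration.integral_cong)
        (auto simp: \<sigma>_def K_def split: split_indicator)
    finally show "signed_set_integral M \<nu> A f = (LINT x|?V. indicator A x * (\<sigma> x * f x))" .
  qed
qed

section \<open>The Hahn-Banach theorem\<close>

text \<open>Scaling is demanded as an inequality only; passing from \<open>c\<close> to
  \<open>1 / c\<close> gives equality. Functionals built as infima thus require one estimate per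
  axiom.\<close>

definition sublinear :: "('b::real_vector \<Rightarrow> real) \<Rightarrow> bool" where
  "sublinear p \<longleftrightarrow> (\<forall>x y. p (x + y) \<le> p x + p y) \<and> (\<forall>c>0. \<forall>x. p (c *\<^sub>R x) \<le> c * p x)"

lemma sublinearI:
  assumes "\<And>x y. p (x + y) \<le> p x + p y" "\<And>c x. 0 < c \<Longrightarrow> p (c *\<^sub>R x) \<le> c * p x"
  shows "sublinear p"
  using assms by (simp add: sublinear_def)

lemma sublinear_add: "sublinear p \<Longrightarrow> p (x + y) \<le> p x + p y"
  by (simp add: sublinear_def)

lemma sublinear_scaleR:
  assumes "sublinear p" "0 < c"
  shows "p (c *\<^sub>R x) = c * p x"
proof (rule antisym)
  show "p (c *\<^sub>R x) \<le> c * p x" using assms by (simp add: sublinear_def)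
  have "p ((1 / c) *\<^sub>R (c *\<^sub>R x)) \<le> (1 / c) * p (c *\<^sub>R x)"
    using assms unfolding sublinear_def by (meson zero_less_divide_1_iff)
  then show "c * p x \<le> p (c *\<^sub>R x)" using assms(2) by (simp add: field_simps)
qed

lemma sublinear_zero: "sublinear p \<Longrightarrow> p 0 = 0"
  using sublinear_scaleR[of p 2 0] unfolding scaleR_zero_right by linarith

lemma sublinear_minus: "sublinear p \<Longrightarrow> - p (- x) \<le> p x"
  using sublinear_add[of p x "- x"] sublinear_zero[of p] by simp

text \<open>The largest sublinear functional below \<open>p\<close> whose value at \<open>-v\<close> is \<open>- p v\<close>.\<close>

definition sublinear_shift :: "('b::real_vector \<Rightarrow> real) \<Rightarrow> 'b \<Rightarrow> 'b \<Rightarrow> real" where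
  "sublinear_shift p v x = (INF t\<in>{0..}. p (x + t *\<^sub>R v) - t * p v)"

context
  fixes p :: "'b::real_vector \<Rightarrow> real" and v :: 'b
  assumes p: "sublinear p"
begin

text \<open>Subadditivity at \<open>t *\<^sub>R v = (x + t *\<^sub>R v) + (- x)\<close> gives a
  bound independent of \<open>t\<close>, so the real infimum in \<open>sublinear_shift\<close> is a
  genuine one.\<close>

lemma sublinear_shift_lower:
  assumes "0 \<le> t" shows "- p (- x) \<le> p (x + t *\<^sub>R v) - t * p v"
proof -
  have "p (t *\<^sub>R v) = t * p v"
    using sublinear_scaleR[OF p] sublinear_zero[OF p] assms by (cases "t = 0") auto
  then show ?thesis using sublinear_add[OF p, of "x + t *\<^sub>R v" "- x"] by simp
qed

lemma sublinear_shift_le: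
  "0 \<le> t \<Longrightarrow> sublinear_shift p v x \<le> p (x + t *\<^sub>R v) - t * p v"
  unfolding sublinear_shift_def
  by (rule cINF_lower) (auto intro!: bdd_belowI2 sublinear_shift_lower)

lemma sublinear_shift_greatest:
  "(\<And>t. 0 \<le> t \<Longrightarrow> a \<le> p (x + t *\<^sub>R v) - t * p v) \<Longrightarrow> a \<le> sublinear_shift p v x"
  unfolding sublinear_shift_def by (rule cINF_greatest) auto

text \<open>The parameters are matched: \<open>s\<close> for \<open>x\<close> and \<open>t\<close>
  for \<open>y\<close> combine to \<open>s + t\<close> for \<open>x + y\<close>, and
  \<open>t\<close> for \<open>x\<close> becomes \<open>c * t\<close> for
  \<open>c *\<^sub>R x\<close>.\<close>

lemma sublinear_sublinear_shift: "sublinear (sublinear_shift p v)"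
proof (rule sublinearI)
  let ?q = "sublinear_shift p v"
  fix x y
  have "?q (x + y) \<le> (p (x + s *\<^sub>R v) - s * p v) + (p (y + t *\<^sub>R v) - t * p v)"
    if "0 \<le> s" "0 \<le> t" for s t
  proof -
    have "?q (x + y) \<le> p ((x + y) + (s + t) *\<^sub>R v) - (s + t) * p v"
      using that by (intro sublinear_shift_le) simp
    moreover have "(x + y) + (s + t) *\<^sub>R v = (x + s *\<^sub>R v) + (y + t *\<^sub>R v)"
      by (simp add: scaleR_add_left)
    ultimately show ?thesis
      using sublinear_add[OF p, of "x + s *\<^sub>R v" "y + t *\<^sub>R v"] by (simp add: algebra_simps)
  qed
  then have "?q (x + y) - (p (x + s *\<^sub>R v) - s * p v) \<le> ?q y" if "0 \<le> s" for s
    using that by (intro sublinear_shift_greatest) (smt (verit))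
  then have "?q (x + y) - ?q y \<le> ?q x"
    by (intro sublinear_shift_greatest) (smt (verit))
  then show "?q (x + y) \<le> ?q x + ?q y" by simp
next
  let ?q = "sublinear_shift p v"
  fix c :: real and x assume c: "0 < c"
  have "?q (c *\<^sub>R x) / c \<le> ?q x"
  proof (rule sublinear_shift_greatest)
    fix t :: real assume "0 \<le> t"
    then have "?q (c *\<^sub>R x) \<le> p (c *\<^sub>R x + (c * t) *\<^sub>R v) - (c * t) * p v"
      using c by (intro sublinear_shift_le) simp
    moreover have "p (c *\<^sub>R x + (c * t) *\<^sub>R v) = c * p (x + t *\<^sub>R v)"
      using sublinear_scaleR[OF p c, of "x + t *\<^sub>R v"] by (simp add: scaleR_add_right)
    ultimately show "?q (c *\<^sub>R x) / c \<le> p (x + t *\<^sub>R v) - t * p v"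
      using c by (simp add: field_simps)
  qed
  then show "?q (c *\<^sub>R x) \<le> c * ?q x" using c by (simp add: field_simps)
qed

lemma sublinear_shift_le_self: "sublinear_shift p v x \<le> p x"
  using sublinear_shift_le[of 0] by simp

lemma sublinear_shift_minus: "sublinear_shift p v (- v) \<le> - p v"
  using sublinear_shift_le[of 1 "- v"] sublinear_zero[OF p] by simp

end

text \<open>A minimal sublinear functional coincides with all its shifts, hence is odd and linear.\<close>

lemma linear_below_sublinear:
  fixes p :: "'b::real_vector \<Rightarrow> real"
  assumes p: "sublinear p"
  obtains f where "linear f" "\<And>x. f x \<le> p x"
proof -
  define A where "A = {q. sublinear q \<and> (\<forall>x. q x \<le> p x)}"
  \<comment> \<open>Zorn's lemma is applied to the reversed pointwise order, so a maximal element is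
    a minimal sublinear functional.\<close>
  have "\<exists>q\<in>A. \<forall>r\<in>A. r \<le> q \<longrightarrow> r = q"
  proof (rule predicate_Zorn)
    show "partial_order_on A (relation_of (\<lambda>q r. r \<le> q) A)"
      by (rule partial_order_on_relation_ofI) auto
    fix C assume C: "C \<in> Chains (relation_of (\<lambda>q r. r \<le> q) A)"
    then have CA: "C \<subseteq> A" and Clin: "\<And>q r. q \<in> C \<Longrightarrow> r \<in> C \<Longrightarrow> q \<le> r \<or> r \<le> q"
      by (auto simp: Chains_def relation_of_def)
    show "\<exists>u\<in>A. \<forall>a\<in>C. u \<le> a"
    proof (cases "C = {}")
      case True
      then show ?thesis using p by (auto simp: A_def)
    next
      case False
      define u where "u x = (INF q\<in>C. q x)" for x
      have low: "- p (- x) \<le> q x" if "q \<in> C" for q x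
      proof -
        have "sublinear q" "q (- x) \<le> p (- x)" using that CA by (auto simp: A_def)
        then show ?thesis using sublinear_minus[of q x] by linarith
      qed
      have u_le: "u x \<le> q x" if "q \<in> C" for q x
        unfolding u_def using that low by (intro cINF_lower bdd_belowI2[of _ "- p (- x)"]) auto
      have u_ge: "a \<le> u x" if "\<And>q. q \<in> C \<Longrightarrow> a \<le> q x" for a x
        unfolding u_def using that False by (intro cINF_greatest) auto
      have "sublinear u"
      proof (rule sublinearI)
        fix x y
        \<comment> \<open>Two members of a chain have a common lower member in it; this keeps the
          pointwise infimum subadditive.\<close>
        have "u (x + y) \<le> q x + r y" if qr: "q \<in> C" "r \<in> C" for q r
        proof -
          obtain s where s: "s \<in> C" "s \<le> q" "s \<le> r" using Clin[OF qr] qr by blast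
          then have "sublinear s" using CA by (auto simp: A_def)
          then have "s (x + y) \<le> s x + s y" by (rule sublinear_add)
          also have "\<dots> \<le> q x + r y" using s by (intro add_mono) (auto simp: le_fun_def)
          finally show ?thesis using u_le[OF s(1), of "x + y"] by simp
        qed
        then have "u (x + y) - q x \<le> u y" if "q \<in> C" for q
          using that by (intro u_ge) (smt (verit))
        then have "u (x + y) - u y \<le> u x"
          by (intro u_ge) (smt (verit))
        then show "u (x + y) \<le> u x + u y" by simp
      next
        fix c :: real and x assume c: "0 < c"
        have "u (c *\<^sub>R x) / c \<le> u x"
        proof (rule u_ge)
          fix q assume q: "q \<in> C"
          then have "sublinear q" using CA by (auto simp: A_def)
          then show "u (c *\<^sub>R x) / c \<le> q x"
            using u_le[OF q, of "c *\<^sub>R x"] c by (simp add: sublinear_scaleR field_simps)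
        qed
        then show "u (c *\<^sub>R x) \<le> c * u x" using c by (simp add: field_simps)
      qed
      moreover have "u x \<le> p x" for x
      proof -
        obtain q where q: "q \<in> C" using False by blast
        then have "q x \<le> p x" using CA by (auto simp: A_def)
        then show ?thesis using u_le[OF q, of x] by linarith
      qed
      ultimately have "u \<in> A" by (simp add: A_def)
      then show ?thesis using u_le by (auto simp: le_fun_def)
    qed
  qed
  then obtain q where q: "sublinear q" "\<And>x. q x \<le> p x" and
    min: "\<And>r. r \<in> A \<Longrightarrow> r \<le> q \<Longrightarrow> r = q"
    by (auto simp: A_def)
  have odd: "q (- v) = - q v" for v
  proof -
    have "sublinear_shift q v \<in> A"
      using sublinear_sublinear_shift[OF q(1), of v] sublinear_shift_le_self[OF q(1), of v] q(2)
      unfolding A_def by (blast intro: order_trans)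
    then have "sublinear_shift q v = q"
      by (rule min) (simp add: le_fun_def sublinear_shift_le_self[OF q(1)])
    then have "q (- v) \<le> - q v" using sublinear_shift_minus[OF q(1), of v] by simp
    then show ?thesis using sublinear_minus[OF q(1), of v] by linarith
  qed
  have "linear q"
  proof (rule linearI)
    fix x y
    show "q (x + y) = q x + q y"
      using sublinear_add[OF q(1), of x y] sublinear_add[OF q(1), of "- x" "- y"]
        odd[of "x + y"] odd[of x] odd[of y] by simp
  next
    fix c :: real and x
    consider "c = 0" | "0 < c" | "0 < - c" by linarith
    then show "q (c *\<^sub>R x) = c *\<^sub>R q x"
    proof cases
      case 1
      then show ?thesis using sublinear_zero[OF q(1)] by simp
    next
      case 2
      then show ?thesis using sublinear_scaleR[OF q(1)] by simp
    next
      case 3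
      then show ?thesis using sublinear_scaleR[OF q(1) 3, of x] odd[of "c *\<^sub>R x"] by simp
    qed
  qed
  then show ?thesis using that q(2) by blast
qed

text \<open>The linear functional is taken below the shift of \<open>p\<close> at \<open>z\<close>,
  which is at most \<open>- p z\<close> at \<open>- z\<close>; linearity then forces the value
  \<open>p z\<close> at \<open>z\<close>. Domination by the norm at \<open>x\<close> and at
  \<open>- x\<close> makes it bounded with norm at most 1.\<close>

theorem Hahn_Banach:
  fixes p :: "'b::real_normed_vector \<Rightarrow> real"
  assumes p: "sublinear p" and le: "\<And>x. p x \<le> norm x"
  obtains y :: "'b \<Rightarrow>\<^sub>L real" where "norm y \<le> 1" "\<And>x. blinfun_apply y x \<le> p x"
    "blinfun_apply y z = p z"
proof -
  obtain f where f: "linear f" "\<And>x. f x \<le> sublinear_shift p z x"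
    using linear_below_sublinear[OF sublinear_sublinear_shift[OF p]] by blast
  have fp: "f x \<le> p x" for x
    using f(2)[of x] sublinear_shift_le_self[OF p, of z x] by linarith
  have neg: "f (- x) = - f x" for x by (rule linear_neg[OF f(1)])
  have "p z \<le> f z" using f(2)[of "- z"] sublinear_shift_minus[OF p, of z] neg by simp
  then have fz: "f z = p z" using fp[of z] by simp
  have nf: "norm (f x) \<le> norm x * 1" for x
    using fp[of x] le[of x] fp[of "- x"] le[of "- x"] neg[of x] by (simp add: abs_le_iff)
  have bl: "bounded_linear f"
    using f(1) nf by (intro bounded_linear_intro[of f 1]) (auto simp: linear_add linear_scale)
  have "norm (Blinfun f) \<le> 1"
    using nf by (intro norm_blinfun_bound) (auto simp: bounded_linear_Blinfun_apply[OF bl])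
  then show ?thesis
    using that[of "Blinfun f"] fp fz by (simp add: bounded_linear_Blinfun_apply[OF bl])
qed

corollary norming_functional:
  fixes z :: "'b::real_normed_vector"
  obtains y :: "'b \<Rightarrow>\<^sub>L real" where "norm y \<le> 1" "blinfun_apply y z = norm z"
proof -
  have "sublinear (norm :: 'b \<Rightarrow> real)" by (rule sublinearI) (auto simp: norm_triangle_ineq)
  then show ?thesis using Hahn_Banach[of norm z] that by blast
qed

lemma blinfun_apply_le_norm:
  fixes y :: "'b::real_normed_vector \<Rightarrow>\<^sub>L real"
  assumes "norm y \<le> 1"
  shows "\<bar>blinfun_apply y z\<bar> \<le> norm z"
proof -
  have "\<bar>blinfun_apply y z\<bar> \<le> norm y * norm z" using norm_blinfun[of y z] by simp
  also have "\<dots> \<le> 1 * norm z" using assms by (intro mult_right_mono) auto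
  finally show ?thesis by simp
qed

text \<open>\<open>p\<close> is the distance to \<open>V\<close>: sublinear because \<open>V\<close>
  is a subspace, at most 0 on \<open>V\<close> and positive at \<open>z\<close>. A functional below
  \<open>p\<close> is nonpositive at \<open>v\<close> and \<open>- v\<close> for \<open>v\<close> in
  \<open>V\<close>, hence zero there.\<close>

corollary separating_functional:
  fixes V :: "'b::real_normed_vector set"
  assumes V: "subspace V" and z: "z \<notin> closure V"
  obtains y :: "'b \<Rightarrow>\<^sub>L real" where "\<And>v. v \<in> V \<Longrightarrow> blinfun_apply y v = 0" "blinfun_apply y z \<noteq> 0"
proof -
  define p where "p x = (INF v\<in>V. norm (x - v))" for x
  have V0: "0 \<in> V" by (rule subspace_0[OF V])
  have p_le: "p x \<le> norm (x - v)" if "v \<in> V" for x v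
    unfolding p_def using that by (intro cINF_lower bdd_belowI2[of _ 0]) auto
  have p_ge: "a \<le> p x" if "\<And>v. v \<in> V \<Longrightarrow> a \<le> norm (x - v)" for a x
    unfolding p_def using that V0 by (intro cINF_greatest) auto
  have sub: "sublinear p"
  proof (rule sublinearI)
    fix x y
    have "p (x + y) \<le> norm (x - v) + norm (y - w)" if "v \<in> V" "w \<in> V" for v w
    proof -
      have "p (x + y) \<le> norm ((x + y) - (v + w))" using subspace_add[OF V that] by (rule p_le)
      also have "\<dots> \<le> norm (x - v) + norm (y - w)"
        using norm_triangle_ineq[of "x - v" "y - w"] by (simp add: algebra_simps)
      finally show ?thesis .
    qed
    then have "p (x + y) - norm (x - v) \<le> p y" if "v \<in> V" for v
      using that by (intro p_ge) (smt (verit))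
    then have "p (x + y) - p y \<le> p x" by (intro p_ge) (smt (verit))
    then show "p (x + y) \<le> p x + p y" by simp
  next
    fix c :: real and x assume c: "0 < c"
    have "p (c *\<^sub>R x) / c \<le> p x"
    proof (rule p_ge)
      fix v assume "v \<in> V"
      then have "p (c *\<^sub>R x) \<le> norm (c *\<^sub>R x - c *\<^sub>R v)"
        by (intro p_le subspace_scale[OF V])
      also have "\<dots> = c * norm (x - v)"
        using c by (simp flip: scaleR_diff_right)
      finally show "p (c *\<^sub>R x) / c \<le> norm (x - v)" using c by (simp add: field_simps)
    qed
    then show "p (c *\<^sub>R x) \<le> c * p x" using c by (simp add: field_simps)
  qed
  have "p x \<le> norm x" for x using p_le[OF V0, of x] by simp
  then obtain y :: "'b \<Rightarrow>\<^sub>L real" where y: "\<And>x. blinfun_apply y x \<le> p x" "blinfun_apply y z = p z"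
    using Hahn_Banach[OF sub, of z] by metis
  have pV: "p v \<le> 0" if "v \<in> V" for v using p_le[OF that, of v] by simp
  show ?thesis
  proof (rule that)
    fix v assume v: "v \<in> V"
    show "blinfun_apply y v = 0"
      using y(1)[of v] y(1)[of "- v"] pV[OF v] pV[OF subspace_neg[OF V v]]
      by (simp add: blinfun.minus_right)
  next
    obtain e where e: "0 < e" "\<And>v. v \<in> V \<Longrightarrow> e \<le> dist v z"
      using z unfolding closure_approachable by (auto simp: not_less)
    have "e \<le> p z" using e(2) by (intro p_ge) (simp add: dist_norm norm_minus_commute)
    then show "blinfun_apply y z \<noteq> 0" using e(1) y(2) by simp
  qed
qed

section \<open>Weakly subseries convergent series\<close>

lemma countable_rational_combinations:
  fixes X :: "'b::real_vector set"
  assumes "countable X"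
  shows "countable (\<Union>t\<in>{t. finite t \<and> t \<subseteq> X}.
    (\<lambda>r. \<Sum>a\<in>t. real_of_rat (r a) *\<^sub>R a) ` (t \<rightarrow>\<^sub>E UNIV))"
  using assms
  by (intro countable_UN countable_image countable_PiE) (auto intro: countable_Collect_finite_subset)

lemma span_approx_rational_combination:
  fixes X :: "'b::real_normed_vector set"
  assumes v: "v \<in> span X" and e: "0 < e"
  obtains t r where "finite t" "t \<subseteq> X" "r \<in> t \<rightarrow>\<^sub>E UNIV"
    "norm (v - (\<Sum>a\<in>t. real_of_rat (r a) *\<^sub>R a)) < e"
proof -
  obtain t c where t: "finite t" "t \<subseteq> X" and v: "v = (\<Sum>a\<in>t. c a *\<^sub>R a)"
    using v unfolding span_explicit by blast
  \<comment> \<open>The 1 added to the cardinality makes the total error strictly smaller than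
    \<open>e\<close>; the 1 added to the norm keeps the quotient defined at the zero vector.\<close>
  define d where "d a = e / ((real (card t) + 1) * (norm a + 1))" for a :: 'b
  have d: "0 < d a" for a using e by (simp add: d_def add_nonneg_pos)
  have "\<exists>q. \<bar>c a - real_of_rat q\<bar> < d a" for a
    using of_rat_dense[of "c a" "c a + d a"] d[of a] by (force simp: abs_if)
  then obtain q where q: "\<And>a. \<bar>c a - real_of_rat (q a)\<bar> < d a" by metis
  let ?r = "restrict q t"
  have "v - (\<Sum>a\<in>t. real_of_rat (?r a) *\<^sub>R a) = (\<Sum>a\<in>t. (c a - real_of_rat (q a)) *\<^sub>R a)"
    unfolding v by (simp add: scaleR_diff_left sum_subtractf)
  also have "norm \<dots> \<le> (\<Sum>a\<in>t. e / (real (card t) + 1))"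
  proof (rule sum_norm_le)
    fix a
    have "norm ((c a - real_of_rat (q a)) *\<^sub>R a) \<le> d a * norm a"
      using q[of a] by (auto intro: mult_right_mono)
    also have "\<dots> \<le> d a * (norm a + 1)" using d[of a] by (intro mult_left_mono) auto
    also have "\<dots> = e / (real (card t) + 1)"
    proof -
      have "norm a + 1 \<noteq> 0" by (smt (verit) norm_ge_zero)
      then show ?thesis by (simp add: d_def)
    qed
    finally show "norm ((c a - real_of_rat (q a)) *\<^sub>R a) \<le> e / (real (card t) + 1)" .
  qed
  also have "\<dots> < e" using e by (simp add: field_simps)
  finally show ?thesis using that[OF t, of ?r] by auto
qed

section \<open>Sums of a weakly subseries convergent series as a function of the index set\<close>

context
  fixes X :: "nat set \<Rightarrow> 'b::real_normed_vector"
  assumes weak: "\<And>S (y :: 'b \<Rightarrow>\<^sub>L real).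
    (\<lambda>n. if n \<in> S then blinfun_apply y (X {n}) else 0) sums blinfun_apply y (X S)"
begin

text \<open>A functional killing every term kills every weak sum, so separation applies. The range
  of \<open>X\<close> is therefore separable, as required for covering it by countably many small
  balls.\<close>

lemma weak_sum_in_closed_span: "X S \<in> closure (span (range (\<lambda>n. X {n})))"
proof (rule ccontr)
  assume "X S \<notin> closure (span (range (\<lambda>n. X {n})))"
  then obtain y :: "'b \<Rightarrow>\<^sub>L real" where y: "\<And>v. v \<in> span (range (\<lambda>n. X {n})) \<Longrightarrow> blinfun_apply y v = 0"
    and "blinfun_apply y (X S) \<noteq> 0"
    using separating_functional[OF subspace_span] by metis
  moreover have "blinfun_apply y (X {n}) = 0" for n by (rule y) (auto intro: span_base)
  then have "blinfun_apply y (X S) = 0" using sums_unique[OF weak[of S y]] by (simp cong: if_cong)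
  ultimately show False by simp
qed

text \<open>The subseries over the indices with nonnegative value and over the complementary indices
  both converge; their difference is the series of absolute values.\<close>

lemma weak_sum_absolutely_summable:
  fixes y :: "'b \<Rightarrow>\<^sub>L real"
  shows "summable (\<lambda>n. \<bar>blinfun_apply y (X {n})\<bar>)"
proof -
  let ?P = "{n. 0 \<le> blinfun_apply y (X {n})}"
  have "summable (\<lambda>n. (if n \<in> ?P then blinfun_apply y (X {n}) else 0) -
      (if n \<in> - ?P then blinfun_apply y (X {n}) else 0))"
    by (intro summable_diff sums_summable[OF weak])
  moreover have "(\<lambda>n. (if n \<in> ?P then blinfun_apply y (X {n}) else 0) -
      (if n \<in> - ?P then blinfun_apply y (X {n}) else 0)) = (\<lambda>n. \<bar>blinfun_apply y (X {n})\<bar>)"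
    by (auto simp: fun_eq_iff)
  ultimately show ?thesis by simp
qed

text \<open>The complement of a closed ball has an open preimage in the Cantor space of index sets:
  a norming functional detects the excess over \<open>e\<close>, and its absolutely summable tail
  tolerates any change of \<open>S\<close> beyond \<open>N\<close>.\<close>

lemma weak_sum_norm_gt_open:
  assumes gt: "e < norm (X S - q)"
  obtains N where "\<And>T. T \<inter> {..<N} = S \<inter> {..<N} \<Longrightarrow> e < norm (X T - q)"
proof -
  obtain y :: "'b \<Rightarrow>\<^sub>L real" where y: "norm y \<le> 1" "blinfun_apply y (X S - q) = norm (X S - q)"
    using norming_functional by blast
  let ?a = "\<lambda>n. blinfun_apply y (X {n})"
  let ?c = "\<lambda>T n. if n \<in> T then ?a n else 0"
  obtain N where N: "\<And>n. n \<ge> N \<Longrightarrow> norm (\<Sum>i. \<bar>?a (i + n)\<bar>) < norm (X S - q) - e"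
    using suminf_exist_split[OF _ weak_sum_absolutely_summable[of y], of "norm (X S - q) - e"] gt
    by auto
  show ?thesis
  proof (rule that)
    fix T assume T: "T \<inter> {..<N} = S \<inter> {..<N}"
    let ?d = "\<lambda>n. ?c S n - ?c T n"
    have sums: "?d sums (blinfun_apply y (X S) - blinfun_apply y (X T))"
      by (intro sums_diff weak)
    have "?d n = 0" if "n < N" for n using T that by auto
    then have "blinfun_apply y (X S) - blinfun_apply y (X T) = (\<Sum>i. ?d (i + N))"
      using suminf_minus_initial_segment[OF sums_summable[OF sums], of N] sums_unique[OF sums] by simp
    also have "\<dots> \<le> (\<Sum>i. \<bar>?a (i + N)\<bar>)"
      using summable_ignore_initial_segment[OF sums_summable[OF sums], of N]
        summable_ignore_initial_segment[OF weak_sum_absolutely_summable[of y], of N]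
      by (intro suminf_le) auto
    also have "\<dots> < norm (X S - q) - e" using N[of N] by simp
    finally have "e < blinfun_apply y (X T - q)" using y(2) by (simp add: blinfun.diff_right)
    also have "\<dots> \<le> norm (X T - q)" using blinfun_apply_le_norm[OF y(1), of "X T - q"] by simp
    finally show "e < norm (X T - q)" .
  qed
qed

text \<open>
  A Baire category argument on the Cantor space of all index sets \<open>S\<close>: countably many
  weakly closed balls cover all the sums, so one of them contains \<open>X S\<close> for all \<open>S\<close> in a cylinder.
\<close>

lemma weak_sum_cylinder_in_ball:
  assumes e: "0 < e"
  shows "\<exists>q N S\<^sub>0. \<forall>S. S \<inter> {..<N} = S\<^sub>0 \<inter> {..<N} \<longrightarrow> norm (X S - q) \<le> e"
proof -
  define D where "D = (\<Union>t\<in>{t. finite t \<and> t \<subseteq> range (\<lambda>n. X {n})}.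
    (\<lambda>r. \<Sum>a\<in>t. real_of_rat (r a) *\<^sub>R a) ` (t \<rightarrow>\<^sub>E UNIV))"
  have D: "countable D" unfolding D_def by (rule countable_rational_combinations) simp
  have near: "\<exists>q\<in>D. norm (X S - q) < e" for S
  proof -
    obtain v where v: "v \<in> span (range (\<lambda>n. X {n}))" "dist v (X S) < e / 2"
      using weak_sum_in_closed_span[of S] e unfolding closure_approachable by (meson half_gt_zero)
    obtain t r where t: "finite t" "t \<subseteq> range (\<lambda>n. X {n})" "r \<in> t \<rightarrow>\<^sub>E UNIV"
      "norm (v - (\<Sum>a\<in>t. real_of_rat (r a) *\<^sub>R a)) < e / 2"
      using span_approx_rational_combination[OF v(1), of "e / 2"] e by auto
    have "(\<Sum>a\<in>t. real_of_rat (r a) *\<^sub>R a) \<in> D" using t unfolding D_def by blast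
    moreover have "norm (X S - (\<Sum>a\<in>t. real_of_rat (r a) *\<^sub>R a)) < e"
      using norm_triangle_ineq[of "X S - v" "v - (\<Sum>a\<in>t. real_of_rat (r a) *\<^sub>R a)"] v(2) t(4)
      by (simp add: dist_norm norm_minus_commute)
    ultimately show ?thesis by blast
  qed
  then have "D \<noteq> {}" by blast
  define q where "q = from_nat_into D"
  have q: "\<exists>k. norm (X S - q k) < e" for S
  proof -
    obtain d where d: "d \<in> D" "norm (X S - d) < e" using near by blast
    then obtain k where "q k = d" using from_nat_into_surj[OF D] unfolding q_def by blast
    then show ?thesis using d(2) by blast
  qed
  have "\<exists>k N S\<^sub>0. \<forall>S. S \<inter> {..<N} = S\<^sub>0 \<inter> {..<N} \<longrightarrow> norm (X S - q k) \<le> e"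
  proof (rule ccontr)
    assume "\<not> ?thesis"
    then have neg: "\<forall>k N S\<^sub>0. \<exists>S. S \<inter> {..<N} = S\<^sub>0 \<inter> {..<N} \<and> e < norm (X S - q k)"
      by (simp only: not_ex not_all not_imp not_le simp_thms)
    \<comment> \<open>A state is a cylinder, given by a length and an index set. The step from
      \<open>x\<close> to \<open>y\<close> refines it so that every sum in the new cylinder lies
      outside the \<open>k\<close>-th ball.\<close>
    define R where "R k x y \<longleftrightarrow> fst x < fst y \<and> snd y \<inter> {..<fst x} = snd x \<inter> {..<fst x} \<and>
      (\<forall>T. T \<inter> {..<fst y} = snd y \<inter> {..<fst y} \<longrightarrow> e < norm (X T - q k))"
      for k and x y :: "nat \<times> nat set"
    have "\<exists>y. R k x y" for k x
    proof -
      obtain S where S: "S \<inter> {..<fst x} = snd x \<inter> {..<fst x}" "e < norm (X S - q k)"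
        using neg[rule_format, of "fst x" "snd x" k] by blast
      obtain N where N: "\<And>T. T \<inter> {..<N} = S \<inter> {..<N} \<Longrightarrow> e < norm (X T - q k)"
        using weak_sum_norm_gt_open[OF S(2)] by blast
      \<comment> \<open>The maximum makes the lengths grow strictly, so stage \<open>k\<close> fixes
        at least the first \<open>k\<close> indices.\<close>
      define N' where "N' = max N (Suc (fst x))"
      have "e < norm (X T - q k)" if T: "T \<inter> {..<N'} = S \<inter> {..<N'}" for T
      proof (rule N)
        have "{..<N} = {..<N'} \<inter> {..<N}" by (auto simp: N'_def)
        then show "T \<inter> {..<N} = S \<inter> {..<N}" using T by (metis Int_assoc)
      qed
      then have "R k x (N', S)" using S by (simp add: R_def N'_def)
      then show ?thesis by blast
    qed
    then obtain f where f: "\<And>k. R k (f k) (f (Suc k))"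
      using dependent_nat_choice[of "\<lambda>_ _. True" R] by auto
    have mono: "fst (f k) < fst (f (Suc k))" for k using f[of k] by (simp add: R_def)
    have ge: "k \<le> fst (f k)" for k
    proof (induction k)
      case (Suc k)
      then show ?case using mono[of k] by simp
    qed simp
    have agree: "snd (f j) \<inter> {..<fst (f k)} = snd (f k) \<inter> {..<fst (f k)}" if "k \<le> j" for k j
      using that
    proof (induction j rule: dec_induct)
      case (step j)
      have "fst (f k) \<le> fst (f j)"
        using lift_Suc_mono_le[of "\<lambda>k. fst (f k)" k j] mono step by (simp add: less_imp_le)
      then have "{..<fst (f k)} = {..<fst (f j)} \<inter> {..<fst (f k)}" by auto
      moreover have "snd (f (Suc j)) \<inter> {..<fst (f j)} = snd (f j) \<inter> {..<fst (f j)}"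
        using f[of j] by (simp add: R_def)
      ultimately show ?case using step.IH by (metis Int_assoc)
    qed simp
    \<comment> \<open>Membership of \<open>n\<close> is read off at stage \<open>n + 1\<close>,
      whose cylinder has length greater than \<open>n\<close>.\<close>
    define T where "T = {n. n \<in> snd (f (Suc n))}"
    have "T \<inter> {..<fst (f k)} = snd (f k) \<inter> {..<fst (f k)}" for k
    proof -
      have "n \<in> snd (f (Suc n)) \<longleftrightarrow> n \<in> snd (f k)" if "n < fst (f k)" for n
      proof (cases "k \<le> Suc n")
        case True
        then show ?thesis using agree[OF True] that by blast
      next
        case False
        then show ?thesis using agree[of "Suc n" k] ge[of "Suc n"] by force
      qed
      then show ?thesis by (auto simp: T_def)
    qed
    then have "e < norm (X T - q k)" for k using f[of k] by (simp add: R_def)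
    then show False using q[of T] by (meson less_asym)
  qed
  then show ?thesis by (elim exE) (intro exI)
qed

text \<open>All index sets in one cylinder have sums in one ball of radius \<open>e / 3\<close>. Two
  of them may differ by a single index \<open>n \<ge> N\<close>, and then their sums differ by the
  term \<open>X {n}\<close>.\<close>

theorem Orlicz_Pettis_null: "(\<lambda>n. X {n}) \<longlonglongrightarrow> 0"
proof (rule LIMSEQ_I)
  fix e :: real assume e: "0 < e"
  then have "0 < e / 3" by simp
  from weak_sum_cylinder_in_ball[OF this] obtain q N S\<^sub>0
    where B: "\<forall>S. S \<inter> {..<N} = S\<^sub>0 \<inter> {..<N} \<longrightarrow> norm (X S - q) \<le> e / 3"
    by (elim exE) (rule that)
  show "\<exists>no. \<forall>n\<ge>no. norm (X {n} - 0) < e"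
  proof (intro exI allI impI)
    fix n assume n: "N \<le> n"
    let ?S = "S\<^sub>0 \<inter> {..<N}"
    obtain y :: "'b \<Rightarrow>\<^sub>L real" where y: "norm y \<le> 1" "blinfun_apply y (X {n}) = norm (X {n})"
      using norming_functional by blast
    have "(\<lambda>i. (if i \<in> ?S then blinfun_apply y (X {i}) else 0) +
        (if i \<in> {n} then blinfun_apply y (X {i}) else 0))
      sums (blinfun_apply y (X ?S) + blinfun_apply y (X {n}))"
      by (intro sums_add weak)
    moreover have "(\<lambda>i. (if i \<in> ?S then blinfun_apply y (X {i}) else 0) +
        (if i \<in> {n} then blinfun_apply y (X {i}) else 0)) =
      (\<lambda>i. if i \<in> insert n ?S then blinfun_apply y (X {i}) else 0)"
      using n by (auto simp: fun_eq_iff)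
    ultimately have "(\<lambda>i. if i \<in> insert n ?S then blinfun_apply y (X {i}) else 0)
      sums (blinfun_apply y (X ?S) + blinfun_apply y (X {n}))"
      by (simp only:)
    from sums_unique2[OF weak[of "insert n ?S" y] this]
    have "blinfun_apply y (X (insert n ?S)) = blinfun_apply y (X ?S) + blinfun_apply y (X {n})" .
    then have "norm (X {n}) = blinfun_apply y (X (insert n ?S) - X ?S)"
      using y(2) by (simp add: blinfun.diff_right)
    also have "\<dots> \<le> norm (X (insert n ?S) - X ?S)"
      using blinfun_apply_le_norm[OF y(1), of "X (insert n ?S) - X ?S"] by simp
    also have "\<dots> \<le> norm (X (insert n ?S) - q) + norm (X ?S - q)"
      using norm_triangle_ineq4[of "X (insert n ?S) - q" "X ?S - q"] by simp
    also have "\<dots> \<le> e / 3 + e / 3" using n by (intro add_mono B[rule_format]) auto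
    finally show "norm (X {n} - 0) < e" using e by simp
  qed
qed

end

section \<open>Integrals with respect to a vector measure\<close>

text \<open>Unlike in the classical principle, the test set \<open>Z n\<close> changes with the
  bound \<open>n\<close>, so the conclusion concerns one particular \<open>n\<close>. If
  \<open>E n\<close> contains a ball, comparing its centre with its other points gives the
  bound.\<close>

theorem uniform_boundedness_functionals:
  fixes Z :: "nat \<Rightarrow> 'b::real_normed_vector set"
  assumes ptw: "\<And>y :: 'b \<Rightarrow>\<^sub>L real. \<exists>n. \<forall>z\<in>Z n. \<bar>blinfun_apply y z\<bar> \<le> real n"
  obtains n C where "\<And>(y :: 'b \<Rightarrow>\<^sub>L real) z. norm y \<le> 1 \<Longrightarrow> z \<in> Z n \<Longrightarrow> \<bar>blinfun_apply y z\<bar> \<le> C"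
proof -
  define E where "E n = (\<Inter>z\<in>Z n. {y :: 'b \<Rightarrow>\<^sub>L real. \<bar>blinfun_apply y z\<bar> \<le> real n})" for n
  have closed: "closed (E n)" for n
    unfolding E_def by (intro closed_INT ballI closed_Collect_le continuous_intros)
  have "\<exists>n. interior (E n) \<noteq> {}"
  proof (rule ccontr)
    assume "\<not> ?thesis"
    then have "euclidean interior_of \<Union>(range E) = {}"
      using closed
      by (intro Baire_category_alt disjI1 completely_metrizable_space_euclidean)
        (auto simp: euclidean_interior_of)
    moreover have "\<Union>(range E) = UNIV" using ptw by (auto simp: E_def)
    ultimately show False by (simp add: euclidean_interior_of)
  qed
  then obtain n y\<^sub>0 where "y\<^sub>0 \<in> interior (E n)" by blast
  then obtain r where r: "0 < r" "cball y\<^sub>0 r \<subseteq> E n" unfolding mem_interior_cball by blast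
  have "\<bar>blinfun_apply y z\<bar> \<le> 2 * real n / r" if y: "norm y \<le> 1" and z: "z \<in> Z n"
    for y :: "'b \<Rightarrow>\<^sub>L real" and z
  proof -
    have "y\<^sub>0 + r *\<^sub>R y \<in> E n" "y\<^sub>0 \<in> E n" using r y by (auto simp: dist_norm intro!: subsetD[OF r(2)])
    then have "\<bar>blinfun_apply y\<^sub>0 z + r * blinfun_apply y z\<bar> \<le> real n" "\<bar>blinfun_apply y\<^sub>0 z\<bar> \<le> real n"
      using z by (auto simp: E_def blinfun.add_left blinfun.scaleR_left)
    then have "\<bar>r * blinfun_apply y z\<bar> \<le> 2 * real n" by linarith
    then show ?thesis using r(1) by (simp add: abs_mult field_simps)
  qed
  then show ?thesis using that by blast
qed

text \<open>Rounding down to multiples of \<open>d\<close>; boundedness leaves finitely many values.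
  Preservation of zeros makes the approximant of a truncated function vanish wherever the truncation
  does.\<close>

lemma bounded_simple_approximation:
  fixes u :: "'a \<Rightarrow> real"
  assumes [measurable]: "u \<in> borel_measurable M" and B: "\<And>x. x \<in> space M \<Longrightarrow> \<bar>u x\<bar> \<le> B" and d: "0 < d"
  obtains h where "simple_function M h" "\<And>x. \<bar>u x - h x\<bar> \<le> d" "\<And>x. u x = 0 \<Longrightarrow> h x = 0"
proof -
  define h where "h x = d * of_int \<lfloor>u x / d\<rfloor>" for x
  have "h ` space M \<subseteq> (\<lambda>i. d * of_int i) ` {\<lfloor>- B / d\<rfloor>..\<lfloor>B / d\<rfloor>}"
  proof
    fix t assume "t \<in> h ` space M"
    then obtain x where x: "x \<in> space M" "t = d * of_int \<lfloor>u x / d\<rfloor>" by (auto simp: h_def)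
    have "- B / d \<le> u x / d" "u x / d \<le> B / d"
      using B[OF x(1)] d by (simp_all add: field_simps abs_le_iff)
    then have "\<lfloor>u x / d\<rfloor> \<in> {\<lfloor>- B / d\<rfloor>..\<lfloor>B / d\<rfloor>}" by (auto intro: floor_mono)
    then show "t \<in> (\<lambda>i. d * of_int i) ` {\<lfloor>- B / d\<rfloor>..\<lfloor>B / d\<rfloor>}" using x(2) by blast
  qed
  then have "finite (h ` space M)" by (rule finite_subset) simp
  moreover have "h \<in> borel_measurable M" unfolding h_def by measurable
  ultimately have "simple_function M h" by (intro simple_function_borel_measurable)
  moreover have "\<bar>u x - h x\<bar> \<le> d" for x
  proof -
    have "d * of_int \<lfloor>u x / d\<rfloor> \<le> d * (u x / d)" "d * (u x / d) \<le> d * (of_int \<lfloor>u x / d\<rfloor> + 1)"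
      using d by (intro mult_left_mono; linarith)+
    then have "h x \<le> u x" "u x \<le> h x + d" using d by (simp_all add: h_def distrib_left)
    then show ?thesis by simp
  qed
  moreover have "u x = 0 \<Longrightarrow> h x = 0" for x by (simp add: h_def)
  ultimately show ?thesis using that by blast
qed

lemma simple_function_bounded:
  fixes h :: "'a \<Rightarrow> real"
  assumes "simple_function M h"
  obtains B where "0 \<le> B" "\<And>x. x \<in> space M \<Longrightarrow> \<bar>h x\<bar> \<le> B"
proof -
  define F where "F = insert 0 ((\<lambda>x. \<bar>h x\<bar>) ` space M)"
  have "finite F"
    using finite_imageI[OF simple_functionD(1)[OF assms], of abs] by (simp add: F_def image_image)
  moreover have "0 \<in> F" "x \<in> space M \<Longrightarrow> \<bar>h x\<bar> \<in> F" for x by (auto simp: F_def)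
  ultimately have "0 \<le> Max F" "x \<in> space M \<Longrightarrow> \<bar>h x\<bar> \<le> Max F" for x by (simp_all add: Max_ge)
  then show ?thesis by (rule that)
qed

lemma signed_set_integral_eq_polar:
  fixes \<nu> :: "'a set \<Rightarrow> real"
  assumes vm: "vector_measure M \<nu>"
  obtains \<sigma> where "\<sigma> \<in> borel_measurable M" "\<And>x. \<bar>\<sigma> x\<bar> = 1" "\<And>x. \<sigma> x = 1 \<or> \<sigma> x = -1"
    "\<And>A. A \<in> sets M \<Longrightarrow> \<nu> A = (LINT x|variation_measure M \<nu>. indicator A x * \<sigma> x)"
    "\<And>A f. A \<in> sets M \<Longrightarrow> integrable (variation_measure M \<nu>) f \<Longrightarrow>
       signed_set_integral M \<nu> A f =
         (LINT x|variation_measure M \<nu>. indicator A x * (\<sigma> x * f x))"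
    "\<And>A f. A \<in> sets M \<Longrightarrow> integrable (variation_measure M \<nu>) f \<Longrightarrow>
       integrable (variation_measure M \<nu>) (\<lambda>x. indicator A x * (\<sigma> x * f x))"
proof (rule polar_decomposition[OF vm])
  fix \<sigma>
  assume \<sigma>: "\<sigma> \<in> borel_measurable M" and pm: "\<And>x. \<sigma> x = 1 \<or> \<sigma> x = -1"
    and \<nu>: "\<And>A. A \<in> sets M \<Longrightarrow> \<nu> A = (LINT x|variation_measure M \<nu>. indicator A x * \<sigma> x)"
    and eq: "\<And>A f. A \<in> sets M \<Longrightarrow> integrable (variation_measure M \<nu>) f \<Longrightarrow>
       signed_set_integral M \<nu> A f =
         (LINT x|variation_measure M \<nu>. indicator A x * (\<sigma> x * f x))"
  have abs: "\<bar>\<sigma> x\<bar> = 1" for x using pm[of x] by auto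
  have int: "integrable (variation_measure M \<nu>) (\<lambda>x. indicator A x * (\<sigma> x * f x))"
    if "A \<in> sets M" and f: "integrable (variation_measure M \<nu>) f" for A f
  proof (rule Bochner_Integration.integrable_bound[OF f])
    have "f \<in> borel_measurable M" using borel_measurable_integrable[OF f] by simp
    then show "(\<lambda>x. indicator A x * (\<sigma> x * f x)) \<in> borel_measurable (variation_measure M \<nu>)"
      using that(1) \<sigma> by simp
  qed (auto simp: abs abs_mult split: split_indicator)
  show ?thesis by (rule that[OF \<sigma> abs pm \<nu> eq int])
qed

section \<open>Scalar integrals against the variations of a vector measure\<close>

locale banach_vector_measure =
  fixes M :: "'a measure" and m :: "'a set \<Rightarrow> 'b::banach"
  assumes vm: "vector_measure M m"
begin

abbreviation "V \<equiv> scalar_variation M m"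
abbreviation "I y \<equiv> signed_set_integral M (scalarization m y)"

lemma finite_measure_scalar_variation: "finite_measure (V y)"
  by (rule polar_decomposition[OF vector_measure_scalarization[OF vm, of y]])

lemma integrable_scalar_variation_bounded:
  fixes u :: "'a \<Rightarrow> real"
  assumes "u \<in> borel_measurable M" "\<And>x. x \<in> space M \<Longrightarrow> \<bar>u x\<bar> \<le> B"
  shows "integrable (V y) u"
  using assms
  by (intro finite_measure.integrable_const_bound[OF finite_measure_scalar_variation, of _ B]) auto

lemma integrable_scalar_variation_simple:
  fixes h :: "'a \<Rightarrow> real"
  assumes h: "simple_function M h"
  shows "integrable (V y) h"
proof -
  obtain B where "0 \<le> B" "\<And>x. x \<in> space M \<Longrightarrow> \<bar>h x\<bar> \<le> B"
    using simple_function_bounded[OF h] by blast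
  then show ?thesis
    using borel_measurable_simple_function[OF h] by (intro integrable_scalar_variation_bounded)
qed

lemma signed_set_integral_bound:
  assumes "A \<in> sets M" "integrable (V y) f"
  shows "ennreal \<bar>I y A f\<bar> \<le> (\<integral>\<^sup>+x. ennreal \<bar>f x\<bar> \<partial>V y)"
proof (rule signed_set_integral_eq_polar[OF vector_measure_scalarization[OF vm, of y]])
  fix \<sigma> assume abs: "\<And>x. \<bar>\<sigma> x\<bar> = 1" and eq: "\<And>A f. A \<in> sets M \<Longrightarrow> integrable (V y) f \<Longrightarrow>
     I y A f = (LINT x|V y. indicator A x * (\<sigma> x * f x))" and
    int: "\<And>A f. A \<in> sets M \<Longrightarrow> integrable (V y) f \<Longrightarrow>
     integrable (V y) (\<lambda>x. indicator A x * (\<sigma> x * f x))"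
  have "ennreal \<bar>I y A f\<bar> \<le> (\<integral>\<^sup>+x. ennreal (norm (indicator A x * (\<sigma> x * f x))) \<partial>V y)"
    using integral_norm_bound_ennreal[OF int[OF assms]] by (simp add: eq[OF assms])
  also have "\<dots> \<le> (\<integral>\<^sup>+x. ennreal \<bar>f x\<bar> \<partial>V y)"
    by (intro nn_integral_mono) (auto simp: abs_mult abs split: split_indicator)
  finally show ?thesis .
qed

lemma signed_set_integral_diff:
  assumes "A \<in> sets M" "integrable (V y) f" "integrable (V y) g"
  shows "I y A (\<lambda>x. f x - g x) = I y A f - I y A g"
proof (rule signed_set_integral_eq_polar[OF vector_measure_scalarization[OF vm, of y]])
  fix \<sigma> assume eq: "\<And>A f. A \<in> sets M \<Longrightarrow> integrable (V y) f \<Longrightarrow>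
     I y A f = (LINT x|V y. indicator A x * (\<sigma> x * f x))" and
    int: "\<And>A f. A \<in> sets M \<Longrightarrow> integrable (V y) f \<Longrightarrow>
     integrable (V y) (\<lambda>x. indicator A x * (\<sigma> x * f x))"
  show ?thesis
    using eq[OF assms(1,2)] eq[OF assms(1,3)] eq[OF assms(1) Bochner_Integration.integrable_diff[OF assms(2,3)]]
      Bochner_Integration.integral_diff[OF int[OF assms(1,2)] int[OF assms(1,3)]]
    by (simp add: right_diff_distrib)
qed

text \<open>Dominated convergence with majorant \<open>\<bar>f\<bar>\<close>: disjointness keeps the
  partial sums of the indicators between 0 and 1.\<close>

lemma signed_set_integral_sums:
  fixes D :: "nat \<Rightarrow> 'a set"
  assumes D: "\<And>i. D i \<in> sets M" "\<And>i j. i \<noteq> j \<Longrightarrow> D i \<inter> D j = {}" and f: "integrable (V y) f"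
  shows "(\<lambda>i. I y (D i) f) sums I y (\<Union>i. D i) f"
proof (rule signed_set_integral_eq_polar[OF vector_measure_scalarization[OF vm, of y]])
  fix \<sigma> assume \<sigma>: "\<sigma> \<in> borel_measurable M" and abs: "\<And>x. \<bar>\<sigma> x\<bar> = 1"
    and eq: "\<And>A f. A \<in> sets M \<Longrightarrow> integrable (V y) f \<Longrightarrow>
     I y A f = (LINT x|V y. indicator A x * (\<sigma> x * f x))" and
    int: "\<And>A f. A \<in> sets M \<Longrightarrow> integrable (V y) f \<Longrightarrow>
     integrable (V y) (\<lambda>x. indicator A x * (\<sigma> x * f x))"
  note indicator_sums = indicator_sums[OF D(2)]
  have fm: "f \<in> borel_measurable M" using borel_measurable_integrable[OF f] by simp
  have partial: "(\<Sum>i<n. I y (D i) f) = (LINT x|V y. (\<Sum>i<n. indicator (D i) x) * (\<sigma> x * f x))" for n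
    unfolding eq[OF D(1) f] sum_distrib_right
    by (rule Bochner_Integration.integral_sum[symmetric]) (rule int[OF D(1) f])
  have "(\<lambda>n. LINT x|V y. (\<Sum>i<n. indicator (D i) x) * (\<sigma> x * f x)) \<longlonglongrightarrow>
      (LINT x|V y. indicator (\<Union>i. D i) x * (\<sigma> x * f x))"
  proof (rule integral_dominated_convergence[where w = "\<lambda>x. \<bar>f x\<bar>"])
    show "AE x in V y. (\<lambda>n. (\<Sum>i<n. indicator (D i) x) * (\<sigma> x * f x))
        \<longlonglongrightarrow> indicator (\<Union>i. D i) x * (\<sigma> x * f x)"
      using indicator_sums unfolding sums_def by (intro AE_I2 tendsto_mult_right)
    fix n
    show "AE x in V y. norm ((\<Sum>i<n. indicator (D i) x) * (\<sigma> x * f x)) \<le> \<bar>f x\<bar>"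
    proof (rule AE_I2)
      fix x
      define c where "c = (\<Sum>i<n. indicator (D i) x :: real)"
      have "c \<le> (\<Sum>i. indicator (D i) x)"
        unfolding c_def by (rule sum_le_suminf) (use indicator_sums in \<open>auto simp: sums_iff\<close>)
      also have "\<dots> \<le> 1" using indicator_sums by (simp add: sums_iff indicator_def)
      finally have "c \<le> 1" .
      moreover have "0 \<le> c" unfolding c_def by (rule sum_nonneg) simp
      ultimately show "norm ((\<Sum>i<n. indicator (D i) x) * (\<sigma> x * f x)) \<le> \<bar>f x\<bar>"
        unfolding c_def[symmetric] by (simp add: abs_mult abs mult_left_le_one_le)
    qed
  qed (use D \<sigma> fm f in auto)
  then show ?thesis
    unfolding sums_def partial using D(1) by (subst eq[OF _ f]) auto
qed

lemma simple_function_vector_integral: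
  fixes h :: "'a \<Rightarrow> real"
  assumes h: "simple_function M h" and A: "A \<in> sets M"
  obtains z where "\<And>y. blinfun_apply y z = I y A h"
proof
  let ?B = "\<lambda>c. A \<inter> (h -` {c} \<inter> space M)"
  have B: "?B c \<in> sets M" for c using simple_functionD(2)[OF h] A by simp
  fix y
  show "blinfun_apply y (\<Sum>c\<in>h ` space M. c *\<^sub>R m (?B c)) = I y A h"
  proof (rule signed_set_integral_eq_polar[OF vector_measure_scalarization[OF vm, of y]])
    fix \<sigma> assume m: "\<And>A. A \<in> sets M \<Longrightarrow> scalarization m y A = (LINT x|V y. indicator A x * \<sigma> x)"
     and eq: "\<And>A f. A \<in> sets M \<Longrightarrow> integrable (V y) f \<Longrightarrow>
     I y A f = (LINT x|V y. indicator A x * (\<sigma> x * f x))" and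
    int: "\<And>A f. A \<in> sets M \<Longrightarrow> integrable (V y) f \<Longrightarrow>
     integrable (V y) (\<lambda>x. indicator A x * (\<sigma> x * f x))"
    have int1: "integrable (V y) (\<lambda>x. indicator (?B c) x * \<sigma> x)" for c
      using int[OF B integrable_scalar_variation_bounded[of "\<lambda>_. 1" 1], of c] by simp
    have "I y A h = (LINT x|V y. indicator A x * (\<sigma> x * h x))"
      by (rule eq[OF A integrable_scalar_variation_simple[OF h]])
    also have "\<dots> = (LINT x|V y. (\<Sum>c\<in>h ` space M. c * (indicator (?B c) x * \<sigma> x)))"
    proof (rule Bochner_Integration.integral_cong)
      fix x assume "x \<in> space (V y)"
      then have x: "x \<in> space M" by simp
      have "(\<Sum>c\<in>h ` space M. c * (indicator (?B c) x * \<sigma> x)) =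
          (\<Sum>c\<in>h ` space M. if c = h x then c * (indicator A x * \<sigma> x) else 0)"
        using x by (intro sum.cong) (auto split: split_indicator)
      also have "\<dots> = indicator A x * (\<sigma> x * h x)"
        using x simple_functionD(1)[OF h] by simp
      finally show "indicator A x * (\<sigma> x * h x) = (\<Sum>c\<in>h ` space M. c * (indicator (?B c) x * \<sigma> x))"
        by simp
    qed simp
    also have "\<dots> = (\<Sum>c\<in>h ` space M. c * (LINT x|V y. indicator (?B c) x * \<sigma> x))"
      using int1 by (subst Bochner_Integration.integral_sum) auto
    also have "\<dots> = (\<Sum>c\<in>h ` space M. c * scalarization m y (?B c))"
      using m[OF B] by simp
    finally show ?thesis
      by (simp add: scalarization_def blinfun.sum_right blinfun.scaleR_right)
  qed
qed

section \<open>Variation integrals as suprema of functionals\<close>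

definition dominated_integrals :: "('a \<Rightarrow> real) \<Rightarrow> 'b set" where
  "dominated_integrals u = {z. \<exists>h. simple_function M h \<and> (\<forall>x\<in>space M. \<bar>h x\<bar> \<le> \<bar>u x\<bar>) \<and>
     (\<forall>y. blinfun_apply y z = I y (space M) h)}"

text \<open>For the lower bound, simple functions \<open>g\<close> increasing to
  \<open>\<bar>u\<bar>\<close> are multiplied by \<open>\<sigma>\<close>: the integral of
  \<open>\<sigma> * g\<close> against the scalarization is that of \<open>g\<close> against the
  variation. The sign \<open>\<sigma>\<close> depends on \<open>y\<close>, but the set of vectors
  allows all signs at once.\<close>

lemma nn_integral_scalar_variation_eq_SUP:
  assumes u[measurable]: "u \<in> borel_measurable M"
  shows "(\<integral>\<^sup>+x. ennreal \<bar>u x\<bar> \<partial>V y) = (SUP z\<in>dominated_integrals u. ennreal \<bar>blinfun_apply y z\<bar>)"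
proof (rule antisym)
  show "(SUP z\<in>dominated_integrals u. ennreal \<bar>blinfun_apply y z\<bar>) \<le> (\<integral>\<^sup>+x. ennreal \<bar>u x\<bar> \<partial>V y)"
  proof (rule SUP_least)
    fix z assume "z \<in> dominated_integrals u"
    then obtain h where h: "simple_function M h" "\<forall>x\<in>space M. \<bar>h x\<bar> \<le> \<bar>u x\<bar>"
      "blinfun_apply y z = I y (space M) h"
      unfolding dominated_integrals_def by auto
    have "ennreal \<bar>blinfun_apply y z\<bar> \<le> (\<integral>\<^sup>+x. ennreal \<bar>h x\<bar> \<partial>V y)"
      unfolding h(3) by (rule signed_set_integral_bound[OF sets.top integrable_scalar_variation_simple[OF h(1)]])
    also have "\<dots> \<le> (\<integral>\<^sup>+x. ennreal \<bar>u x\<bar> \<partial>V y)"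
      using h(2) by (intro nn_integral_mono ennreal_leI) simp
    finally show "ennreal \<bar>blinfun_apply y z\<bar> \<le> (\<integral>\<^sup>+x. ennreal \<bar>u x\<bar> \<partial>V y)" .
  qed
  have u': "(\<lambda>x. ennreal \<bar>u x\<bar>) \<in> borel_measurable M" by measurable
  obtain F where F: "\<And>i. simple_function M (F i)" "incseq F" "\<And>i x. F i x < top"
    "\<And>x. (SUP i. F i x) = ennreal \<bar>u x\<bar>"
    by (rule borel_measurable_implies_simple_function_sequence'[OF u']) (rule that)
  have "(\<integral>\<^sup>+x. F i x \<partial>V y) \<le> (SUP z\<in>dominated_integrals u. ennreal \<bar>blinfun_apply y z\<bar>)" for i
  proof (rule signed_set_integral_eq_polar[OF vector_measure_scalarization[OF vm, of y]])
    fix \<sigma> assume \<sigma>: "\<sigma> \<in> borel_measurable M" and abs: "\<And>x. \<bar>\<sigma> x\<bar> = 1" and pm: "\<And>x. \<sigma> x = 1 \<or> \<sigma> x = -1"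
      and eq: "\<And>A f. A \<in> sets M \<Longrightarrow> integrable (V y) f \<Longrightarrow>
       I y A f = (LINT x|V y. indicator A x * (\<sigma> x * f x))"
    define g where "g x = enn2real (F i x)" for x
    define h where "h x = \<sigma> x * g x" for x
    have g: "simple_function M g" unfolding g_def by (rule simple_function_compose1[OF F(1)])
    have "simple_function M \<sigma>"
      using \<sigma> pm by (intro simple_function_borel_measurable finite_subset[of "\<sigma> ` space M" "{1, -1}"]) auto
    then have h: "simple_function M h" unfolding h_def using g by (rule simple_function_mult)
    have g0: "0 \<le> g x" for x by (simp add: g_def)
    have Fg: "F i x = ennreal (g x)" for x using F(3) by (simp add: g_def less_top)
    have "ennreal (g x) \<le> ennreal \<bar>u x\<bar>" for x
      unfolding Fg[symmetric] F(4)[symmetric] by (rule SUP_upper) simp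
    then have gu: "g x \<le> \<bar>u x\<bar>" for x by simp
    obtain z where z: "\<And>y. blinfun_apply y z = I y (space M) h"
      by (rule simple_function_vector_integral[OF h sets.top]) (rule that)
    have "z \<in> dominated_integrals u"
      unfolding dominated_integrals_def using h z gu g0 by (auto simp: h_def abs_mult abs intro!: exI[of _ h])
    moreover have "(\<integral>\<^sup>+x. F i x \<partial>V y) = ennreal \<bar>blinfun_apply y z\<bar>"
    proof -
      have "blinfun_apply y z = (LINT x|V y. g x)"
        unfolding z eq[OF sets.top integrable_scalar_variation_simple[OF h]]
      proof (rule Bochner_Integration.integral_cong)
        fix x assume "x \<in> space (V y)"
        then show "indicator (space M) x * (\<sigma> x * h x) = g x"
          using pm[of x] by (auto simp: h_def)
      qed simp
      moreover have "(\<integral>\<^sup>+x. ennreal (g x) \<partial>V y) = ennreal (LINT x|V y. g x)"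
        using g0 by (intro nn_integral_eq_integral integrable_scalar_variation_simple g) auto
      moreover have "0 \<le> (LINT x|V y. g x)" using g0 by simp
      ultimately show ?thesis unfolding Fg by simp
    qed
    ultimately show ?thesis by (auto intro: SUP_upper2)
  qed
  moreover have "(\<integral>\<^sup>+x. ennreal \<bar>u x\<bar> \<partial>V y) = (SUP i. \<integral>\<^sup>+x. F i x \<partial>V y)"
    unfolding F(4)[symmetric]
    using F(1,2) by (intro nn_integral_monotone_convergence_SUP borel_measurable_simple_function) simp_all
  ultimately show "(\<integral>\<^sup>+x. ennreal \<bar>u x\<bar> \<partial>V y) \<le> (SUP z\<in>dominated_integrals u. ennreal \<bar>blinfun_apply y z\<bar>)"
    by (simp add: SUP_least)
qed

lemma nn_integral_le_L1w_norm:
  "norm y \<le> 1 \<Longrightarrow> (\<integral>\<^sup>+x. ennreal \<bar>u x\<bar> \<partial>V y) \<le> L1w_norm M m u"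
  unfolding L1w_norm_def by (rule SUP_upper) simp

lemma L1w_norm_leI:
  "(\<And>y. norm y \<le> 1 \<Longrightarrow> (\<integral>\<^sup>+x. ennreal \<bar>u x\<bar> \<partial>V y) \<le> K) \<Longrightarrow> L1w_norm M m u \<le> K"
  unfolding L1w_norm_def by (rule SUP_least) simp

lemma nn_integral_le_norm_mult_L1w_norm:
  assumes u: "u \<in> borel_measurable M"
  shows "(\<integral>\<^sup>+x. ennreal \<bar>u x\<bar> \<partial>V y) \<le> ennreal (norm y) * L1w_norm M m u"
  unfolding nn_integral_scalar_variation_eq_SUP[OF u, of y]
proof (rule SUP_least)
  fix z assume z: "z \<in> dominated_integrals u"
  show "ennreal \<bar>blinfun_apply y z\<bar> \<le> ennreal (norm y) * L1w_norm M m u"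
  proof (cases "y = 0")
    case False
    define y' where "y' = (1 / norm y) *\<^sub>R y"
    have "norm y' \<le> 1" using False by (simp add: y'_def)
    have "ennreal \<bar>blinfun_apply y' z\<bar> \<le> (\<integral>\<^sup>+x. ennreal \<bar>u x\<bar> \<partial>V y')"
      unfolding nn_integral_scalar_variation_eq_SUP[OF u] using z by (rule SUP_upper)
    also have "\<dots> \<le> L1w_norm M m u" by (rule nn_integral_le_L1w_norm) fact
    finally have "ennreal (norm y) * ennreal \<bar>blinfun_apply y' z\<bar> \<le> ennreal (norm y) * L1w_norm M m u"
      by (rule mult_left_mono) simp
    moreover have "\<bar>blinfun_apply y z\<bar> = norm y * \<bar>blinfun_apply y' z\<bar>"
      using False by (simp add: y'_def blinfun.scaleR_left abs_mult)
    ultimately show ?thesis by (simp add: ennreal_mult)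
  qed simp
qed

text \<open>Finiteness on the unit ball extends to every \<open>y\<close> by homogeneity, so later
  membership claims come from norm estimates.\<close>

lemma L1w_normD:
  assumes u: "u \<in> borel_measurable M" and fin: "L1w_norm M m u < \<infinity>"
  shows "u \<in> L1w M m"
proof -
  have "integrable (V y) u" for y
  proof (rule integrableI_bounded)
    show "u \<in> borel_measurable (V y)" using u by simp
    have "(\<integral>\<^sup>+x. ennreal \<bar>u x\<bar> \<partial>V y) \<le> ennreal (norm y) * L1w_norm M m u"
      by (rule nn_integral_le_norm_mult_L1w_norm[OF u])
    also have "\<dots> < \<infinity>" using fin by (simp add: ennreal_mult_less_top)
    finally show "(\<integral>\<^sup>+x. ennreal (norm (u x)) \<partial>V y) < \<infinity>" by simp
  qed
  then show ?thesis using u by (simp add: L1w_def)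
qed

text \<open>The function may vary with \<open>n\<close>, so a scaling constant depending on
  \<open>y\<close> can be absorbed together with the bound on the integral.\<close>

lemma L1w_norm_finite_Baire:
  fixes u :: "nat \<Rightarrow> 'a \<Rightarrow> real"
  assumes u: "\<And>n. u n \<in> borel_measurable M"
    and ptw: "\<And>y. \<exists>n. (\<integral>\<^sup>+x. ennreal \<bar>u n x\<bar> \<partial>V y) \<le> ennreal (real n)"
  obtains n where "L1w_norm M m (u n) < \<infinity>"
proof -
  have "\<exists>n. \<forall>z\<in>dominated_integrals (u n). \<bar>blinfun_apply y z\<bar> \<le> real n" for y
  proof -
    obtain n where n: "(\<integral>\<^sup>+x. ennreal \<bar>u n x\<bar> \<partial>V y) \<le> ennreal (real n)" using ptw by blast
    have "\<bar>blinfun_apply y z\<bar> \<le> real n" if "z \<in> dominated_integrals (u n)" for z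
    proof -
      have "ennreal \<bar>blinfun_apply y z\<bar> \<le> (\<integral>\<^sup>+x. ennreal \<bar>u n x\<bar> \<partial>V y)"
        unfolding nn_integral_scalar_variation_eq_SUP[OF u] using that by (rule SUP_upper)
      also note n
      finally show ?thesis by simp
    qed
    then show ?thesis by blast
  qed
  then show ?thesis
  proof (rule uniform_boundedness_functionals)
    fix n and C :: real
    assume C: "\<And>y z. norm y \<le> 1 \<Longrightarrow> z \<in> dominated_integrals (u n) \<Longrightarrow> \<bar>blinfun_apply y z\<bar> \<le> C"
    have "L1w_norm M m (u n) \<le> ennreal C"
      unfolding L1w_norm_def nn_integral_scalar_variation_eq_SUP[OF u]
      using C by (intro SUP_least ennreal_leI) simp
    also have "\<dots> < \<infinity>" by simp
    finally show ?thesis by (rule that)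
  qed
qed

lemma semivariation_finite:
  obtains K where "0 \<le> K" "L1w_norm M m (\<lambda>_. 1) = ennreal K"
proof -
  have "\<exists>n. (\<integral>\<^sup>+x. ennreal \<bar>1\<bar> \<partial>V y) \<le> ennreal (real n)" for y
  proof -
    interpret finite_measure "V y" by (rule finite_measure_scalar_variation)
    obtain n where "measure (V y) (space M) \<le> real n" using real_arch_simple by blast
    then show ?thesis
      using emeasure_eq_measure[of "space M"] by (auto intro!: exI[of _ n] ennreal_leI)
  qed
  then obtain n :: nat where "L1w_norm M m (\<lambda>_. 1) < \<infinity>"
    by (rule L1w_norm_finite_Baire[rotated]) auto
  then show ?thesis using that[of "enn2real (L1w_norm M m (\<lambda>_. 1))"] by (simp add: less_top)
qed

text \<open>Monotonicity, triangle inequality and homogeneity of the norm in one estimate, driven by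
  a pointwise bound.\<close>

lemma L1w_norm_le_add:
  assumes u: "u \<in> borel_measurable M" and v: "v \<in> borel_measurable M" and ab: "0 \<le> a" "0 \<le> b"
    and le: "\<And>x. x \<in> space M \<Longrightarrow> \<bar>w x\<bar> \<le> a * \<bar>u x\<bar> + b * \<bar>v x\<bar>"
  shows "L1w_norm M m w \<le> ennreal a * L1w_norm M m u + ennreal b * L1w_norm M m v"
proof (rule L1w_norm_leI)
  fix y :: "'b \<Rightarrow>\<^sub>L real" assume y: "norm y \<le> 1"
  have "(\<integral>\<^sup>+x. ennreal \<bar>w x\<bar> \<partial>V y) \<le> (\<integral>\<^sup>+x. ennreal a * ennreal \<bar>u x\<bar> + ennreal b * ennreal \<bar>v x\<bar> \<partial>V y)"
  proof (rule nn_integral_mono)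
    fix x assume "x \<in> space (V y)"
    then have "ennreal \<bar>w x\<bar> \<le> ennreal (a * \<bar>u x\<bar> + b * \<bar>v x\<bar>)" using le by (intro ennreal_leI) simp
    then show "ennreal \<bar>w x\<bar> \<le> ennreal a * ennreal \<bar>u x\<bar> + ennreal b * ennreal \<bar>v x\<bar>"
      using ab by (simp add: ennreal_mult)
  qed
  also have "\<dots> = ennreal a * (\<integral>\<^sup>+x. ennreal \<bar>u x\<bar> \<partial>V y) + ennreal b * (\<integral>\<^sup>+x. ennreal \<bar>v x\<bar> \<partial>V y)"
    using u v by (simp add: nn_integral_add nn_integral_cmult)
  also have "\<dots> \<le> ennreal a * L1w_norm M m u + ennreal b * L1w_norm M m v"
    using y by (intro add_mono mult_left_mono nn_integral_le_L1w_norm) auto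
  finally show "(\<integral>\<^sup>+x. ennreal \<bar>w x\<bar> \<partial>V y) \<le> \<dots>" .
qed

text \<open>The vector integrals of the approximating simple functions are Cauchy, since a norming
  functional bounds their distances by the norm of the difference of the functions. Completeness of
  the range space supplies a limit, which represents the integral of \<open>g\<close> for each
  \<open>y\<close>.\<close>

theorem L1_closure:
  assumes g: "g \<in> borel_measurable M"
    and approx: "\<And>e. 0 < e \<Longrightarrow> \<exists>h. simple_function M h \<and> L1w_norm M m (\<lambda>x. g x - h x) \<le> ennreal e"
  shows "g \<in> L1 M m"
proof -
  have "\<exists>h. \<forall>n. simple_function M (h n) \<and> L1w_norm M m (\<lambda>x. g x - h n x) \<le> ennreal (1 / Suc n)"
    by (intro choice allI approx) simp
  then obtain h where h: "\<And>n. simple_function M (h n)"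
    and gh: "\<And>n. L1w_norm M m (\<lambda>x. g x - h n x) \<le> ennreal (1 / Suc n)"
    by blast
  have hm: "h n \<in> borel_measurable M" for n by (rule borel_measurable_simple_function[OF h])
  have ghm: "(\<lambda>x. g x - h n x) \<in> borel_measurable M" for n using g hm by measurable
  have gw: "g \<in> L1w M m"
  proof -
    have "(\<lambda>x. g x - h 0 x) \<in> L1w M m"
    proof (rule L1w_normD[OF ghm])
      have "L1w_norm M m (\<lambda>x. g x - h 0 x) \<le> ennreal (1 / Suc 0)" by (rule gh)
      also have "\<dots> < \<infinity>" by simp
      finally show "L1w_norm M m (\<lambda>x. g x - h 0 x) < \<infinity>" .
    qed
    then have "integrable (V y) (\<lambda>x. (g x - h 0 x) + h 0 x)" for y
      using integrable_scalar_variation_simple[OF h]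
      by (intro Bochner_Integration.integrable_add) (simp_all add: L1w_def)
    then show ?thesis using g by (simp add: L1w_def)
  qed
  then have gi: "integrable (V y) g" for y by (simp add: L1w_def)
  note hi = integrable_scalar_variation_simple[OF h]
  have "\<exists>z. \<forall>y. blinfun_apply y z = I y A g" if A: "A \<in> sets M" for A
  proof -
    have "\<exists>z. \<forall>n y. blinfun_apply y (z n) = I y A (h n)"
    proof (intro choice allI)
      fix n
      obtain z where "\<And>y. blinfun_apply y z = I y A (h n)"
        by (rule simple_function_vector_integral[OF h A]) (rule that)
      then show "\<exists>z. \<forall>y. blinfun_apply y z = I y A (h n)" by blast
    qed
    then obtain z where z: "\<And>n y. blinfun_apply y (z n) = I y A (h n)" by blast
    have "norm (z n - z k) \<le> 1 / Suc n + 1 / Suc k" for n k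
    proof -
      obtain y :: "'b \<Rightarrow>\<^sub>L real" where y: "norm y \<le> 1" "blinfun_apply y (z n - z k) = norm (z n - z k)"
        by (rule norming_functional) (rule that)
      have "norm (z n - z k) = I y A (\<lambda>x. h n x - h k x)"
        using y(2) by (simp add: blinfun.diff_right z signed_set_integral_diff[OF A hi hi])
      then have "ennreal (norm (z n - z k)) \<le> ennreal \<bar>I y A (\<lambda>x. h n x - h k x)\<bar>"
        by (intro ennreal_leI) simp
      also have "\<dots> \<le> (\<integral>\<^sup>+x. ennreal \<bar>h n x - h k x\<bar> \<partial>V y)"
        using hi by (intro signed_set_integral_bound A) simp
      also have "\<dots> \<le> L1w_norm M m (\<lambda>x. h n x - h k x)" by (rule nn_integral_le_L1w_norm[OF y(1)])
      also have "\<dots> \<le> ennreal 1 * L1w_norm M m (\<lambda>x. g x - h n x) + ennreal 1 * L1w_norm M m (\<lambda>x. g x - h k x)"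
        by (rule L1w_norm_le_add[OF ghm ghm]) auto
      also have "\<dots> \<le> ennreal (1 / Suc n) + ennreal (1 / Suc k)"
        using gh by (intro add_mono) simp_all
      also have "\<dots> = ennreal (1 / Suc n + 1 / Suc k)" by (simp add: ennreal_plus)
      finally show ?thesis by (subst (asm) ennreal_le_iff) auto
    qed
    note zdiff = this
    have "Cauchy z"
    proof (rule CauchyI)
      fix e :: real assume "0 < e"
      then obtain N where N: "1 / real (Suc N) < e / 2" using nat_approx_posE[of "e / 2"] by auto
      show "\<exists>N. \<forall>n\<ge>N. \<forall>k\<ge>N. norm (z n - z k) < e"
      proof (intro exI allI impI)
        fix n k assume "N \<le> n" "N \<le> k"
        then have "1 / real (Suc n) \<le> 1 / Suc N" "1 / real (Suc k) \<le> 1 / Suc N"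
          by (simp_all add: frac_le)
        then show "norm (z n - z k) < e" using zdiff[of n k] N by linarith
      qed
    qed
    then obtain w where w: "z \<longlonglongrightarrow> w" by (auto simp: Cauchy_convergent_iff convergent_def)
    have "blinfun_apply y w = I y A g" for y
    proof (rule LIMSEQ_unique)
      show "(\<lambda>n. blinfun_apply y (z n)) \<longlonglongrightarrow> blinfun_apply y w"
        by (intro tendsto_intros w)
      have "\<bar>I y A g - I y A (h n)\<bar> \<le> norm y * (1 / Suc n)" for n
      proof -
        have "ennreal \<bar>I y A g - I y A (h n)\<bar> \<le> (\<integral>\<^sup>+x. ennreal \<bar>g x - h n x\<bar> \<partial>V y)"
          unfolding signed_set_integral_diff[OF A gi hi, symmetric]
          using gi hi by (intro signed_set_integral_bound A) simp
        also have "\<dots> \<le> ennreal (norm y) * L1w_norm M m (\<lambda>x. g x - h n x)"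
          by (rule nn_integral_le_norm_mult_L1w_norm[OF ghm])
        also have "\<dots> \<le> ennreal (norm y) * ennreal (1 / Suc n)"
          by (intro mult_left_mono gh) simp
        also have "\<dots> = ennreal (norm y * (1 / Suc n))" by (rule ennreal_mult[symmetric]) simp_all
        finally show ?thesis by (subst (asm) ennreal_le_iff) auto
      qed
      then have "\<forall>\<^sub>F n in sequentially. norm (I y A g - I y A (h n)) \<le> norm y * (1 / Suc n)"
        by (intro always_eventually allI) simp
      moreover have "(\<lambda>n. norm y * (1 / Suc n)) \<longlonglongrightarrow> 0"
        by (intro tendsto_mult_right_zero LIMSEQ_Suc lim_1_over_n)
      ultimately have "(\<lambda>n. I y A g - I y A (h n)) \<longlonglongrightarrow> 0" by (rule Lim_null_comparison)
      then have "(\<lambda>n. I y A g - (I y A g - I y A (h n))) \<longlonglongrightarrow> I y A g - 0"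
        by (intro tendsto_diff tendsto_const)
      then show "(\<lambda>n. blinfun_apply y (z n)) \<longlonglongrightarrow> I y A g" by (simp add: z)
    qed
    then show ?thesis by blast
  qed
  then show ?thesis using gw by (simp add: L1_def)
qed

text \<open>On \<open>A\<close> the function is discarded at cost \<open>e / 2\<close>. The
  remaining bounded part is uniformly within \<open>d\<close> of a simple function, which costs at
  most \<open>d\<close> times the semivariation \<open>K\<close> of the space.\<close>

lemma L1_if_bounded_off_small_sets:
  assumes g: "g \<in> borel_measurable M"
    and small: "\<And>e. 0 < e \<Longrightarrow> \<exists>A\<in>sets M. \<exists>B. (\<forall>x\<in>space M - A. \<bar>g x\<bar> \<le> B) \<and>
       L1w_norm M m (\<lambda>x. indicator A x * g x) \<le> ennreal e"
  shows "g \<in> L1 M m"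
proof (rule L1_closure[OF g])
  fix e :: real assume e: "0 < e"
  obtain K where K: "0 \<le> K" "L1w_norm M m (\<lambda>_. 1) = ennreal K"
    by (rule semivariation_finite) (rule that)
  have "0 < e / 2" using e by simp
  from small[OF this] obtain A B where A: "A \<in> sets M" and B: "\<And>x. x \<in> space M - A \<Longrightarrow> \<bar>g x\<bar> \<le> B"
    and le: "L1w_norm M m (\<lambda>x. indicator A x * g x) \<le> ennreal (e / 2)"
    by blast
  \<comment> \<open>Chosen so that \<open>d * K \<le> e / 2\<close>; the added 1 covers
    \<open>K = 0\<close>.\<close>
  define d where "d = e / (2 * (K + 1))"
  have d: "0 < d" "d * K \<le> e / 2" using e K by (auto simp: d_def field_simps)
  define u where "u x = indicator (space M - A) x * g x" for x
  have um: "u \<in> borel_measurable M" unfolding u_def using A g by measurable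
  have "\<bar>u x\<bar> \<le> max 0 B" if "x \<in> space M" for x
    using B[of x] that by (auto simp: u_def split: split_indicator)
  then obtain h where h: "simple_function M h" "\<And>x. \<bar>u x - h x\<bar> \<le> d"
    using bounded_simple_approximation[OF um _ d(1)] by metis
  have "L1w_norm M m (\<lambda>x. g x - h x) \<le>
      ennreal 1 * L1w_norm M m (\<lambda>x. indicator A x * g x) + ennreal d * L1w_norm M m (\<lambda>_. 1)"
  proof (rule L1w_norm_le_add)
    fix x assume x: "x \<in> space M"
    then have "g x - h x = indicator A x * g x + (u x - h x)" by (simp add: u_def split: split_indicator)
    then show "\<bar>g x - h x\<bar> \<le> 1 * \<bar>indicator A x * g x\<bar> + d * \<bar>1\<bar>"
      using h(2)[of x] abs_triangle_ineq[of "indicator A x * g x" "u x - h x"] by simp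
  qed (use A g d in auto)
  also have "\<dots> \<le> ennreal (e / 2) + ennreal (d * K)"
    using le d K by (intro add_mono) (simp_all add: ennreal_mult)
  also have "\<dots> = ennreal (e / 2 + d * K)" using e d K by (intro ennreal_plus[symmetric]) auto
  also have "\<dots> \<le> ennreal e" using d by (intro ennreal_leI) simp
  finally show "\<exists>h. simple_function M h \<and> L1w_norm M m (\<lambda>x. g x - h x) \<le> ennreal e" using h(1) by blast
qed

text \<open>Splitting \<open>A\<close> by the sign of \<open>\<sigma>\<close> writes the variation
  integral as \<open>I y P g - I y N g\<close>, so one of the two terms exceeds \<open>e / 2\<close>
  in absolute value.\<close>

lemma signed_set_integral_large_subset:
  assumes g: "integrable (V y) g" "\<And>x. 0 \<le> g x" and A: "A \<in> sets M"
    and e: "ennreal e < (\<integral>\<^sup>+x. ennreal \<bar>indicator A x * g x\<bar> \<partial>V y)" "0 \<le> e"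
  obtains B where "B \<in> sets M" "B \<subseteq> A" "e / 2 < \<bar>I y B g\<bar>"
proof (rule signed_set_integral_eq_polar[OF vector_measure_scalarization[OF vm, of y]])
  fix \<sigma> assume \<sigma>[measurable]: "\<sigma> \<in> borel_measurable M" and pm: "\<And>x. \<sigma> x = 1 \<or> \<sigma> x = -1"
    and eq: "\<And>A f. A \<in> sets M \<Longrightarrow> integrable (V y) f \<Longrightarrow>
     I y A f = (LINT x|V y. indicator A x * (\<sigma> x * f x))" and
    int: "\<And>A f. A \<in> sets M \<Longrightarrow> integrable (V y) f \<Longrightarrow>
     integrable (V y) (\<lambda>x. indicator A x * (\<sigma> x * f x))"
  define P where "P = A \<inter> {x \<in> space M. \<sigma> x = 1}"
  define N where "N = A \<inter> {x \<in> space M. \<sigma> x = -1}"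
  have PN: "P \<in> sets M" "N \<in> sets M" using A unfolding P_def N_def by measurable
  have Ag: "integrable (V y) (\<lambda>x. indicator A x * g x)"
    using integrable_mult_indicator[of A "V y" g] A g(1) by simp
  have "I y P g - I y N g =
      (LINT x|V y. indicator P x * (\<sigma> x * g x) - indicator N x * (\<sigma> x * g x))"
    unfolding eq[OF PN(1) g(1)] eq[OF PN(2) g(1)]
    by (rule Bochner_Integration.integral_diff[symmetric]) (rule int[OF PN(1) g(1)] int[OF PN(2) g(1)])+
  also have "\<dots> = (LINT x|V y. indicator A x * g x)"
  proof (rule Bochner_Integration.integral_cong)
    fix x assume "x \<in> space (V y)"
    then show "indicator P x * (\<sigma> x * g x) - indicator N x * (\<sigma> x * g x) = indicator A x * g x"
      using pm[of x] by (auto simp: P_def N_def split: split_indicator)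
  qed simp
  finally have 1: "I y P g - I y N g = (LINT x|V y. indicator A x * g x)" .
  have "(\<integral>\<^sup>+x. ennreal \<bar>indicator A x * g x\<bar> \<partial>V y) = ennreal (LINT x|V y. indicator A x * g x)"
    using Ag g(2) by (subst nn_integral_eq_integral[symmetric]) auto
  then have "e < I y P g - I y N g" using e unfolding 1 by (simp add: ennreal_less_iff)
  then have "e / 2 < \<bar>I y P g\<bar> \<or> e / 2 < \<bar>I y N g\<bar>" by linarith
  then show ?thesis
  proof
    assume "e / 2 < \<bar>I y P g\<bar>"
    then show ?thesis using that[OF PN(1)] by (simp add: P_def)
  next
    assume "e / 2 < \<bar>I y N g\<bar>"
    then show ?thesis using that[OF PN(2)] by (simp add: N_def)
  qed
qed

text \<open>Each point eventually leaves \<open>A k\<close>, so dominated convergence applies. A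
  hump \<open>B\<close> can thus be cut off at a late \<open>A k\<close>, which makes room for the
  next hump.\<close>

lemma signed_set_integral_Diff_tendsto:
  assumes g: "integrable (V y) g" and A: "\<And>n. A n \<in> sets M" "decseq A" "(\<Inter>n. A n) = {}" and B: "B \<in> sets M"
  shows "(\<lambda>k. I y (B - A k) g) \<longlonglongrightarrow> I y B g"
proof (rule signed_set_integral_eq_polar[OF vector_measure_scalarization[OF vm, of y]])
  fix \<sigma> assume \<sigma>: "\<sigma> \<in> borel_measurable M" and abs: "\<And>x. \<bar>\<sigma> x\<bar> = 1"
    and eq: "\<And>A f. A \<in> sets M \<Longrightarrow> integrable (V y) f \<Longrightarrow>
     I y A f = (LINT x|V y. indicator A x * (\<sigma> x * f x))"
  have gm: "g \<in> borel_measurable M" using borel_measurable_integrable[OF g] by simp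
  have BA: "B - A k \<in> sets M" for k using A(1) B by simp
  have "(\<lambda>k. LINT x|V y. indicator (B - A k) x * (\<sigma> x * g x)) \<longlonglongrightarrow>
      (LINT x|V y. indicator B x * (\<sigma> x * g x))"
  proof (rule integral_dominated_convergence[where w = "\<lambda>x. \<bar>g x\<bar>"])
    show "AE x in V y. (\<lambda>k. indicator (B - A k) x * (\<sigma> x * g x)) \<longlonglongrightarrow> indicator B x * (\<sigma> x * g x)"
    proof (rule AE_I2, rule tendsto_eventually)
      fix x
      obtain n where "x \<notin> A n" using A(3) by auto
      then have "indicator (B - A k) x = (indicator B x :: real)" if "n \<le> k" for k
        using decseqD[OF A(2) that] by (auto split: split_indicator)
      then show "\<forall>\<^sub>F k in sequentially. indicator (B - A k) x * (\<sigma> x * g x) = indicator B x * (\<sigma> x * g x)"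
        unfolding eventually_sequentially by auto
    qed
    show "AE x in V y. norm (indicator (B - A k) x * (\<sigma> x * g x)) \<le> \<bar>g x\<bar>" for k
      by (intro AE_I2) (auto simp: abs_mult abs split: split_indicator)
    show "(\<lambda>x. indicator B x * (\<sigma> x * g x)) \<in> borel_measurable (V y)" using B \<sigma> gm by simp
    show "(\<lambda>x. indicator (B - A k) x * (\<sigma> x * g x)) \<in> borel_measurable (V y)" for k
      using BA[of k] \<sigma> gm by simp
    show "integrable (V y) (\<lambda>x. \<bar>g x\<bar>)" using g by simp
  qed
  then show ?thesis unfolding eq[OF B g] eq[OF BA g] .
qed

text \<open>
  If the norms stay above \<open>e\<close>, a gliding hump yields disjoint sets \<open>C j\<close> on which the vector
  integral of \<open>g\<close> has norm at least \<open>e / 2\<close>; as the vector integrals over unions of the \<open>C j\<close>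
  exist, this contradicts the Orlicz-Pettis theorem.
\<close>

theorem L1_order_continuous:
  assumes g: "g \<in> L1 M m" "\<And>x. 0 \<le> g x"
    and A: "\<And>n. A n \<in> sets M" "decseq A" "(\<Inter>n::nat. A n) = {}" and e: "0 < e"
  obtains n where "L1w_norm M m (\<lambda>x. indicator (A n) x * g x) \<le> ennreal e"
proof (rule ccontr)
  assume "\<not> thesis"
  then have gt: "ennreal e < L1w_norm M m (\<lambda>x. indicator (A n) x * g x)" for n
    using that by (meson not_le)
  have gi: "integrable (V y) g" for y using g(1) by (simp add: L1_def L1w_def)
  \<comment> \<open>A state pairs an index into \<open>A\<close> with the hump found on the way to
    it.\<close>
  define R where "R p q \<longleftrightarrow> fst p < fst q \<and> snd q \<in> sets M \<and> snd q \<subseteq> A (fst p) - A (fst q) \<and>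
    (\<exists>y. norm y \<le> 1 \<and> e / 2 < \<bar>I y (snd q) g\<bar>)" for p q :: "nat \<times> 'a set"
  have "\<exists>q. R p q" for p
  proof -
    obtain y where y: "norm y \<le> 1" "ennreal e < (\<integral>\<^sup>+x. ennreal \<bar>indicator (A (fst p)) x * g x\<bar> \<partial>V y)"
      using gt[of "fst p"] unfolding L1w_norm_def less_SUP_iff by auto
    obtain B where B: "B \<in> sets M" "B \<subseteq> A (fst p)" "e / 2 < \<bar>I y B g\<bar>"
      by (rule signed_set_integral_large_subset[OF gi g(2) A(1) y(2)]) (use e that in auto)
    have "(\<lambda>k. \<bar>I y (B - A k) g\<bar>) \<longlonglongrightarrow> \<bar>I y B g\<bar>"
      by (intro tendsto_rabs signed_set_integral_Diff_tendsto gi A B)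
    then have "\<forall>\<^sub>F k in sequentially. e / 2 < \<bar>I y (B - A k) g\<bar>"
      using B(3) by (rule order_tendstoD)
    then have "\<forall>\<^sub>F k in sequentially. e / 2 < \<bar>I y (B - A k) g\<bar> \<and> fst p < k"
      by (intro eventually_conj eventually_gt_at_top)
    then obtain k where k: "e / 2 < \<bar>I y (B - A k) g\<bar>" "fst p < k"
      unfolding eventually_sequentially by blast
    have "B - A k \<in> sets M" using A(1) B(1) by simp
    moreover have "B - A k \<subseteq> A (fst p) - A k" using B(2) by blast
    ultimately have "R p (k, B - A k)" using k y(1) unfolding R_def fst_conv snd_conv by blast
    then show ?thesis by blast
  qed
  then obtain f where f: "\<And>j. R (f j) (f (Suc j))"
    using dependent_nat_choice[of "\<lambda>_ _. True" "\<lambda>_. R"] by auto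
  define n where "n j = fst (f j)" for j
  \<comment> \<open>State \<open>j + 1\<close> stores the hump between \<open>A (n j)\<close> and
    \<open>A (n (Suc j))\<close>, hence the shift.\<close>
  define C where "C j = snd (f (Suc j))" for j
  have nC: "n j < n (Suc j)" "C j \<in> sets M" "C j \<subseteq> A (n j) - A (n (Suc j))"
    "\<exists>y. norm y \<le> 1 \<and> e / 2 < \<bar>I y (C j) g\<bar>" for j
    using f[of j] by (simp_all add: R_def n_def C_def)
  have mono: "n i \<le> n j" if "i \<le> j" for i j
    using lift_Suc_mono_le[of n i j] nC(1) that by (simp add: less_imp_le)
  have lt: "C i \<inter> C j = {}" if "i < j" for i j
  proof -
    have "C j \<subseteq> A (n (Suc i))" using nC(3)[of j] decseqD[OF A(2) mono[of "Suc i" j]] that by auto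
    then show ?thesis using nC(3)[of i] by blast
  qed
  have disj: "C i \<inter> C j = {}" if "i \<noteq> j" for i j
    using lt[of i j] lt[of j i] that by (cases "i < j") auto
  \<comment> \<open>Here membership in \<open>L1\<close> enters: the union over any index set is
    measurable, so its vector integral exists.\<close>
  have "\<exists>X. \<forall>S y. blinfun_apply y (X S) = I y (\<Union>j\<in>S. C j) g"
  proof (intro choice allI)
    fix S :: "nat set"
    have "(\<Union>j\<in>S. C j) \<in> sets M" using nC(2) by (intro sets.countable_UN') auto
    then show "\<exists>z. \<forall>y. blinfun_apply y z = I y (\<Union>j\<in>S. C j) g" using g(1) by (auto simp: L1_def)
  qed
  then obtain X where X: "\<And>S y. blinfun_apply y (X S) = I y (\<Union>j\<in>S. C j) g" by blast
  have "(\<lambda>j. X {j}) \<longlonglongrightarrow> 0"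
  proof (rule Orlicz_Pettis_null)
    fix S and y :: "'b \<Rightarrow>\<^sub>L real"
    have "(\<lambda>j. I y (if j \<in> S then C j else {}) g) sums I y (\<Union>j. if j \<in> S then C j else {}) g"
      using nC(2) disj by (intro signed_set_integral_sums gi) auto
    moreover have "(\<Union>j. if j \<in> S then C j else {}) = (\<Union>j\<in>S. C j)" by (auto split: if_splits)
    moreover have "I y {} g = 0" by (simp add: signed_set_integral_def set_lebesgue_integral_def)
    then have "(\<lambda>j. I y (if j \<in> S then C j else {}) g) = (\<lambda>j. if j \<in> S then blinfun_apply y (X {j}) else 0)"
      by (auto simp: X)
    ultimately show "(\<lambda>j. if j \<in> S then blinfun_apply y (X {j}) else 0) sums blinfun_apply y (X S)"
      by (simp only: X)
  qed
  then have "\<forall>\<^sub>F j in sequentially. norm (X {j}) < e / 2"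
    using e tendstoD[of "\<lambda>j. X {j}" 0 sequentially "e / 2"] by simp
  then obtain j where j: "norm (X {j}) < e / 2" unfolding eventually_sequentially by blast
  obtain y where y: "norm y \<le> 1" "e / 2 < \<bar>I y (C j) g\<bar>" using nC(4) by blast
  have "\<bar>I y (C j) g\<bar> \<le> norm (X {j})" using blinfun_apply_le_norm[OF y(1), of "X {j}"] by (simp add: X)
  then show False using y(2) j by simp
qed

lemma bounded_in_L1:
  assumes "u \<in> borel_measurable M" "\<And>x. x \<in> space M \<Longrightarrow> \<bar>u x\<bar> \<le> B"
  shows "u \<in> L1 M m"
proof (rule L1_if_bounded_off_small_sets[OF assms(1)])
  show "\<exists>A\<in>sets M. \<exists>B. (\<forall>x\<in>space M - A. \<bar>u x\<bar> \<le> B) \<and> L1w_norm M m (\<lambda>x. indicator A x * u x) \<le> ennreal e" for e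
    using assms(2) by (intro bexI[of _ "{}"] exI[of _ B]) (auto simp: L1w_norm_def)
qed

text \<open>The superlevel sets of a real-valued \<open>u\<close> decrease to the empty set. Keeping
  \<open>u\<close> apart from \<open>g\<close> allows cutting by the size of \<open>f\<close> while
  measuring 1 or \<open>\<Phi>(\<bar>f\<bar> / c)\<close>.\<close>

lemma L1_tail:
  assumes g: "g \<in> L1 M m" "\<And>x. 0 \<le> g x" and u: "u \<in> borel_measurable M" and e: "0 < e"
  obtains n :: nat where "L1w_norm M m (\<lambda>x. indicator {x \<in> space M. real n < u x} x * g x) \<le> ennreal e"
proof (rule L1_order_continuous[OF g _ _ _ e])
  show "{x \<in> space M. real n < u x} \<in> sets M" for n using u by measurable
  show "decseq (\<lambda>n. {x \<in> space M. real n < u x})" by (auto simp: decseq_def)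
  show "(\<Inter>n. {x \<in> space M. real n < u x}) = {}"
  proof -
    have "\<exists>n. u x \<le> real n" for x by (rule real_arch_simple)
    then show ?thesis by (auto simp: not_less[symmetric])
  qed
qed (rule that)

end

section \<open>Young functions and Orlicz spaces\<close>

lemma orlicz_class_scaled_iff:
  assumes "0 < k" "f \<in> borel_measurable M"
  shows "(\<lambda>x. \<bar>f x\<bar> / k) \<in> orlicz_class \<Phi> M X \<longleftrightarrow> (\<lambda>x. \<Phi> (\<bar>f x\<bar> / k)) \<in> X"
  using assms by (simp add: orlicz_class_def)

lemma orlicz_space_iff:
  "f \<in> orlicz_space \<Phi> M X \<longleftrightarrow> f \<in> borel_measurable M \<and> (\<exists>c>0. (\<lambda>x. \<Phi> (\<bar>f x\<bar> / c)) \<in> X)"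
  unfolding orlicz_space_def by (auto simp: orlicz_class_scaled_iff)

section \<open>Elementary estimates for Young functions\<close>

locale young =
  fixes \<Phi> :: "real \<Rightarrow> real"
  assumes young: "young_function \<Phi>"
begin

lemma young_nonneg: "0 \<le> t \<Longrightarrow> 0 \<le> \<Phi> t"
  using young unfolding young_function_def by auto

lemma young_mono: "0 \<le> s \<Longrightarrow> s \<le> t \<Longrightarrow> \<Phi> s \<le> \<Phi> t"
  using young strict_mono_onD[of "{0..}" \<Phi> s t] unfolding young_function_def
  by (cases "s = t") auto

lemma young_zero: "\<Phi> 0 = 0"
  using young unfolding young_function_def by blast

lemma young_convex: "convex_on {0..} \<Phi>"
  using young unfolding young_function_def by blast

lemma young_scale:
  assumes "0 \<le> a" "a \<le> 1" "0 \<le> t"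
  shows "\<Phi> (a * t) \<le> a * \<Phi> t"
  using convex_onD[OF young_convex assms(1,2), of 0 t] assms(3) by (simp add: young_zero)

text \<open>Convexity at the midpoint of \<open>2 * s\<close> and \<open>2 * t\<close>; it stands in
  for a triangle inequality when a function is split into a small and a bounded part.\<close>

lemma young_midpoint:
  assumes "0 \<le> s" "0 \<le> t"
  shows "\<Phi> (s + t) \<le> 1 / 2 * \<Phi> (2 * s) + 1 / 2 * \<Phi> (2 * t)"
proof -
  have "\<Phi> ((1 - 1 / 2) *\<^sub>R (2 * s) + (1 / 2) *\<^sub>R (2 * t)) \<le> (1 - 1 / 2) * \<Phi> (2 * s) + 1 / 2 * \<Phi> (2 * t)"
    using assms by (intro convex_onD[OF young_convex]) auto
  then show ?thesis by simp
qed

text \<open>\<open>\<Phi>\<close> is constrained on the nonnegative half-line only; composing with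
  \<open>max 0\<close> gives a function continuous on the whole line with the same values
  here.\<close>

lemma borel_measurable_young:
  assumes [measurable]: "f \<in> borel_measurable M" and k: "0 < k"
  shows "(\<lambda>x. \<Phi> (\<bar>f x\<bar> / k)) \<in> borel_measurable M"
proof -
  have "continuous_on UNIV (\<lambda>t. \<Phi> (max 0 t))"
  proof (rule continuous_on_compose2[where g = \<Phi> and f = "max 0"])
    show "continuous_on {0..} \<Phi>" using young unfolding young_function_def by blast
    show "continuous_on UNIV (max (0::real))" by (intro continuous_intros)
  qed auto
  then have [measurable]: "(\<lambda>t. \<Phi> (max 0 t)) \<in> borel_measurable borel"
    by (rule borel_measurable_continuous_onI)
  have "(\<lambda>x. \<Phi> (max 0 (\<bar>f x\<bar> / k))) \<in> borel_measurable M" by measurable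
  moreover have "max 0 (\<bar>f x\<bar> / k) = \<bar>f x\<bar> / k" for x using k by (simp add: max_def)
  ultimately show ?thesis by simp
qed

lemma young_quotient_mono: "0 < c \<Longrightarrow> c \<le> k \<Longrightarrow> \<Phi> (\<bar>r\<bar> / k) \<le> \<Phi> (\<bar>r\<bar> / c)"
  by (intro young_mono divide_left_mono) auto

lemma young_quotient_nonneg: "0 < c \<Longrightarrow> 0 \<le> \<Phi> (\<bar>r\<bar> / c)"
  by (intro young_nonneg) simp

text \<open>The doubling inequality is iterated until the power of 2 reaches \<open>K\<close>, which
  costs the constant \<open>C ^ n\<close>.\<close>

lemma Delta2_scale:
  assumes "Delta2 \<Phi>" "0 \<le> K"
  obtains C where "0 \<le> C" "\<And>t. 0 \<le> t \<Longrightarrow> \<Phi> (K * t) \<le> C * \<Phi> t"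
proof -
  obtain C where C: "1 < C" "\<And>t. 0 \<le> t \<Longrightarrow> \<Phi> (2 * t) \<le> C * \<Phi> t"
    using assms(1) unfolding Delta2_def by blast
  have pow: "\<Phi> (2 ^ n * t) \<le> C ^ n * \<Phi> t" if t: "0 \<le> t" for n t
  proof (induction n)
    case (Suc n)
    have "\<Phi> (2 ^ Suc n * t) \<le> C * \<Phi> (2 ^ n * t)"
      using C(2)[of "2 ^ n * t"] t by (simp add: mult.assoc)
    also have "\<dots> \<le> C * (C ^ n * \<Phi> t)" using Suc C by (intro mult_left_mono) auto
    finally show ?case by (simp add: mult.assoc)
  qed simp
  obtain n where n: "K \<le> 2 ^ n" using real_arch_pow[of 2 K] by (auto intro: less_imp_le)
  show ?thesis
  proof (rule that)
    show "0 \<le> C ^ n" using C by simp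
    fix t :: real assume t: "0 \<le> t"
    have "\<Phi> (K * t) \<le> \<Phi> (2 ^ n * t)" using assms(2) t n by (intro young_mono mult_right_mono) auto
    also note pow[OF t]
    finally show "\<Phi> (K * t) \<le> C ^ n * \<Phi> t" .
  qed
qed

end

section \<open>Comparison of the Orlicz spaces of a vector measure\<close>

locale vector_measure_young = banach_vector_measure M m + young \<Phi>
  for M :: "'a measure" and m :: "'a set \<Rightarrow> 'b::banach" and \<Phi>
begin

lemma LPhi_w_iff:
  "f \<in> LPhi_w \<Phi> M m \<longleftrightarrow>
    f \<in> borel_measurable M \<and> (\<forall>y. \<exists>c>0. integrable (V y) (\<lambda>x. \<Phi> (\<bar>f x\<bar> / c)))"
  unfolding LPhi_w_def LPhi_classical_def by (simp add: orlicz_space_iff)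

text \<open>Since \<open>\<Phi>(\<bar>f\<bar> / c)\<close> decreases in \<open>c\<close>, any
  \<open>n\<close> above both the constant belonging to \<open>y\<close> and the corresponding
  integral serves as scale and as bound. The Baire lemma then selects one \<open>n\<close> for which
  the norm is finite.\<close>

lemma LPhi_w_eq: "LPhi_w \<Phi> M m = orlicz_space \<Phi> M (L1w M m)"
proof (intro set_eqI iffI)
  fix f assume "f \<in> orlicz_space \<Phi> M (L1w M m)"
  then show "f \<in> LPhi_w \<Phi> M m" unfolding LPhi_w_iff orlicz_space_iff L1w_def by blast
next
  fix f assume f: "f \<in> LPhi_w \<Phi> M m"
  then have fm: "f \<in> borel_measurable M" by (simp add: LPhi_w_iff)
  \<comment> \<open>The scale is \<open>n + 1\<close>, so that \<open>n = 0\<close> is a legitimate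
    index.\<close>
  have meas: "(\<lambda>x. \<Phi> (\<bar>f x\<bar> / (real n + 1))) \<in> borel_measurable M" for n
    by (rule borel_measurable_young[OF fm]) simp
  have "\<exists>n. (\<integral>\<^sup>+x. ennreal \<bar>\<Phi> (\<bar>f x\<bar> / (real n + 1))\<bar> \<partial>V y) \<le> ennreal (real n)" for y
  proof -
    obtain c where c: "0 < c" "integrable (V y) (\<lambda>x. \<Phi> (\<bar>f x\<bar> / c))"
      using f unfolding LPhi_w_iff by blast
    obtain n where n: "max c (LINT x|V y. \<Phi> (\<bar>f x\<bar> / c)) \<le> real n" using real_arch_simple by blast
    have "(\<integral>\<^sup>+x. ennreal \<bar>\<Phi> (\<bar>f x\<bar> / (real n + 1))\<bar> \<partial>V y) \<le> (\<integral>\<^sup>+x. ennreal (\<Phi> (\<bar>f x\<bar> / c)) \<partial>V y)"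
    proof (intro nn_integral_mono ennreal_leI)
      fix x
      show "\<bar>\<Phi> (\<bar>f x\<bar> / (real n + 1))\<bar> \<le> \<Phi> (\<bar>f x\<bar> / c)"
        using young_quotient_mono[of c "real n + 1" "f x"] young_quotient_nonneg[of "real n + 1" "f x"] c n
        by simp
    qed
    also have "\<dots> = ennreal (LINT x|V y. \<Phi> (\<bar>f x\<bar> / c))"
      using c by (intro nn_integral_eq_integral) (auto intro: young_quotient_nonneg)
    also have "\<dots> \<le> ennreal (real n)" using n by (intro ennreal_leI) simp
    finally show ?thesis by blast
  qed
  with meas show "f \<in> orlicz_space \<Phi> M (L1w M m)"
  proof (rule L1w_norm_finite_Baire)
    fix n assume "L1w_norm M m (\<lambda>x. \<Phi> (\<bar>f x\<bar> / (real n + 1))) < \<infinity>"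
    then have "(\<lambda>x. \<Phi> (\<bar>f x\<bar> / (real n + 1))) \<in> L1w M m" by (rule L1w_normD[OF meas])
    moreover have "0 < real n + 1" by simp
    ultimately have "\<exists>c>0. (\<lambda>x. \<Phi> (\<bar>f x\<bar> / c)) \<in> L1w M m"
      by (intro exI[of _ "real n + 1"] conjI)
    then show ?thesis unfolding orlicz_space_iff by (rule conjI[OF fm])
  qed
qed

lemma LPhi_w_norm_le:
  assumes f: "f \<in> borel_measurable M" and k: "0 < k"
    and le: "L1w_norm M m (\<lambda>x. \<Phi> (\<bar>f x\<bar> / k)) \<le> 1"
  shows "LPhi_w_norm \<Phi> M m f \<le> ennreal k"
  unfolding LPhi_w_norm_def
proof (rule SUP_least)
  fix y :: "'b \<Rightarrow>\<^sub>L real" assume "y \<in> cball 0 1"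
  then have "norm y \<le> 1" by simp
  from order_trans[OF nn_integral_le_L1w_norm[OF this] le]
  have "(\<integral>\<^sup>+x. ennreal \<bar>\<Phi> (\<bar>f x\<bar> / k)\<bar> \<partial>V y) \<le> 1" .
  moreover have "L1w_norm M m (\<lambda>x. \<Phi> (\<bar>f x\<bar> / k)) < \<infinity>"
    using le by (rule le_less_trans) simp
  then have "integrable (V y) (\<lambda>x. \<Phi> (\<bar>f x\<bar> / k))"
    using L1w_normD[OF borel_measurable_young[OF f k]] by (simp add: L1w_def)
  ultimately show "luxemburg_norm \<Phi> (V y) f \<le> ennreal k"
    unfolding luxemburg_norm_def orlicz_norm_def using k f
    by (intro INF_lower) (simp add: orlicz_class_scaled_iff)
qed

text \<open>Strictness provides for each \<open>y\<close> a feasible scale \<open>c < k\<close>,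
  depending on \<open>y\<close>; monotonicity of \<open>\<Phi>\<close> transfers its bound to the
  common \<open>k\<close>.\<close>

lemma L1w_norm_le_one_if_LPhi_w_norm_less:
  assumes f: "f \<in> borel_measurable M" and k: "LPhi_w_norm \<Phi> M m f < ennreal k"
  shows "L1w_norm M m (\<lambda>x. \<Phi> (\<bar>f x\<bar> / k)) \<le> 1"
proof (rule L1w_norm_leI)
  fix y :: "'b \<Rightarrow>\<^sub>L real" assume "norm y \<le> 1"
  then have "luxemburg_norm \<Phi> (V y) f \<le> LPhi_w_norm \<Phi> M m f"
    unfolding LPhi_w_norm_def by (intro SUP_upper) simp
  also note k
  finally obtain c where c: "0 < c" "c < k" "(\<integral>\<^sup>+x. ennreal \<bar>\<Phi> (\<bar>f x\<bar> / c)\<bar> \<partial>V y) \<le> 1"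
    unfolding luxemburg_norm_def orlicz_norm_def INF_less_iff by (auto simp: ennreal_less_iff)
  have "(\<integral>\<^sup>+x. ennreal \<bar>\<Phi> (\<bar>f x\<bar> / k)\<bar> \<partial>V y) \<le> (\<integral>\<^sup>+x. ennreal \<bar>\<Phi> (\<bar>f x\<bar> / c)\<bar> \<partial>V y)"
  proof (intro nn_integral_mono ennreal_leI)
    fix x
    show "\<bar>\<Phi> (\<bar>f x\<bar> / k)\<bar> \<le> \<bar>\<Phi> (\<bar>f x\<bar> / c)\<bar>"
      using young_quotient_mono[of c k "f x"] young_quotient_nonneg[of k "f x"] c by simp
  qed
  also note c(3)
  finally show "(\<integral>\<^sup>+x. ennreal \<bar>\<Phi> (\<bar>f x\<bar> / k)\<bar> \<partial>V y) \<le> 1" .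
qed

text \<open>A real \<open>k\<close> strictly above the left-hand side satisfies the bound 1
  uniformly in \<open>y\<close>, and the finite norm gives membership in \<open>L1w\<close>; so no
  \<open>k\<close> can lie strictly between the two sides.\<close>

lemma LPhi_w_norm_eq:
  assumes f: "f \<in> borel_measurable M"
  shows "LPhi_w_norm \<Phi> M m f = orlicz_norm \<Phi> M (L1w M m) (L1w_norm M m) f"
proof (rule antisym)
  show "LPhi_w_norm \<Phi> M m f \<le> orlicz_norm \<Phi> M (L1w M m) (L1w_norm M m) f"
    unfolding orlicz_norm_def by (rule INF_greatest) (use f in \<open>auto intro: LPhi_w_norm_le\<close>)
  show "orlicz_norm \<Phi> M (L1w M m) (L1w_norm M m) f \<le> LPhi_w_norm \<Phi> M m f"
  proof (rule ccontr)
    assume "\<not> ?thesis"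
    then have "LPhi_w_norm \<Phi> M m f < orlicz_norm \<Phi> M (L1w M m) (L1w_norm M m) f"
      by (simp only: not_le)
    from dense[OF this] obtain t
      where t: "LPhi_w_norm \<Phi> M m f < t" "t < orlicz_norm \<Phi> M (L1w M m) (L1w_norm M m) f"
      by (elim exE conjE) (rule that)
    define k where "k = enn2real t"
    have tk: "t = ennreal k" using less_le_trans[OF t(2) top_greatest] by (simp add: k_def)
    have "0 < ennreal k" using le_less_trans[OF zero_le t(1)] unfolding tk .
    then have k: "0 < k" by simp
    have le: "L1w_norm M m (\<lambda>x. \<Phi> (\<bar>f x\<bar> / k)) \<le> 1"
      using t(1) unfolding tk by (rule L1w_norm_le_one_if_LPhi_w_norm_less[OF f])
    have "L1w_norm M m (\<lambda>x. \<Phi> (\<bar>f x\<bar> / k)) < \<infinity>" using le by (rule le_less_trans) simp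
    then have "(\<lambda>x. \<Phi> (\<bar>f x\<bar> / k)) \<in> L1w M m" by (rule L1w_normD[OF borel_measurable_young[OF f k]])
    then have "orlicz_norm \<Phi> M (L1w M m) (L1w_norm M m) f \<le> ennreal k"
      unfolding orlicz_norm_def using k f le by (intro INF_lower) (simp add: orlicz_class_scaled_iff)
    then show False using t(2) unfolding tk by simp
  qed
qed

text \<open>For a simple \<open>s\<close> close to \<open>f\<close>, convexity gives
  \<open>\<Phi>(\<bar>f\<bar>) \<le> k * \<Phi>(\<bar>f - s\<bar> / k) + c / 2\<close>, where
  \<open>c\<close> bounds \<open>\<Phi>(2 * \<bar>s\<bar>)\<close>. The first term has norm at most
  \<open>k\<close>; on \<open>{\<bar>f\<bar> > n}\<close> the second is small for large
  \<open>n\<close> by order continuity at the constant 1. Membership is thus obtained with scale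
  1.\<close>

lemma LPhi_subset: "LPhi \<Phi> M m \<subseteq> orlicz_space \<Phi> M (L1 M m)"
proof
  fix f assume f: "f \<in> LPhi \<Phi> M m"
  then have fm: "f \<in> borel_measurable M" by (simp add: LPhi_def LPhi_w_iff)
  let ?g = "\<lambda>x. \<Phi> (\<bar>f x\<bar> / 1)"
  have "?g \<in> L1 M m"
  proof (rule L1_if_bounded_off_small_sets[OF borel_measurable_young[OF fm zero_less_one]])
    fix e :: real assume e: "0 < e"
    \<comment> \<open>\<open>2 * k \<le> 1\<close> lets convexity pull the factor
      \<open>2 * k\<close> out of \<open>\<Phi>\<close>; \<open>2 * k \<le> e\<close> reserves half
      of \<open>e\<close> for the other term.\<close>
    define k where "k = min e 1 / 2"
    have k: "0 < k" "2 * k \<le> 1" "2 * k \<le> e" using e by (auto simp: k_def)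
    obtain s where s: "simple_function M s" "LPhi_w_norm \<Phi> M m (\<lambda>x. f x - s x) < ennreal k"
      using f k(1) unfolding LPhi_def by blast
    have sm: "s \<in> borel_measurable M" by (rule borel_measurable_simple_function[OF s(1)])
    have dm: "(\<lambda>x. f x - s x) \<in> borel_measurable M" using fm sm by measurable
    let ?d = "\<lambda>x. \<Phi> (\<bar>f x - s x\<bar> / k)"
    have d: "L1w_norm M m ?d \<le> 1" by (rule L1w_norm_le_one_if_LPhi_w_norm_less[OF dm s(2)])
    obtain S where S: "0 \<le> S" "\<And>x. x \<in> space M \<Longrightarrow> \<bar>s x\<bar> \<le> S"
      by (rule simple_function_bounded[OF s(1)]) (rule that)
    define c where "c = \<Phi> (2 * S)"
    have c: "0 \<le> c" unfolding c_def using S by (intro young_nonneg) simp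
    have one: "(\<lambda>_. 1) \<in> L1 M m" by (rule bounded_in_L1[where B = 1]) auto
    \<comment> \<open>Multiplied by \<open>c / 2\<close>, this tail bound contributes at most
      \<open>e / 2\<close>, also when \<open>c = 0\<close>.\<close>
    have "0 < e / (c + 1)" using e c by simp
    then obtain n :: nat where
      n: "L1w_norm M m (\<lambda>x. indicator {x \<in> space M. real n < \<bar>f x\<bar>} x * 1) \<le> ennreal (e / (c + 1))"
      by (rule L1_tail[OF one _ borel_measurable_abs[OF fm], rotated]) (use that in auto)
    let ?A = "{x \<in> space M. real n < \<bar>f x\<bar>}"
    have A: "?A \<in> sets M" using fm by measurable
    have "L1w_norm M m (\<lambda>x. indicator ?A x * ?g x) \<le>
        ennreal k * L1w_norm M m ?d + ennreal (1 / 2 * c) * L1w_norm M m (\<lambda>x. indicator ?A x * 1)"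
    proof (rule L1w_norm_le_add)
      show "?d \<in> borel_measurable M" by (rule borel_measurable_young[OF dm k(1)])
      fix x assume x: "x \<in> space M"
      have "?g x \<le> \<Phi> (\<bar>f x - s x\<bar> + \<bar>s x\<bar>)" by (intro young_mono) auto
      also have "\<dots> \<le> 1 / 2 * \<Phi> (2 * \<bar>f x - s x\<bar>) + 1 / 2 * \<Phi> (2 * \<bar>s x\<bar>)"
        by (rule young_midpoint) auto
      also have "\<Phi> (2 * \<bar>f x - s x\<bar>) \<le> 2 * k * ?d x"
        using young_scale[of "2 * k" "\<bar>f x - s x\<bar> / k"] k by simp
      also have "\<Phi> (2 * \<bar>s x\<bar>) \<le> c" unfolding c_def using S(2)[OF x] by (intro young_mono) auto
      finally have "?g x \<le> k * ?d x + 1 / 2 * c" by simp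
      then show "\<bar>indicator ?A x * ?g x\<bar> \<le> k * \<bar>?d x\<bar> + 1 / 2 * c * \<bar>indicator ?A x * 1\<bar>"
        using young_quotient_nonneg[of k "f x - s x"] young_quotient_nonneg[of 1 "f x"] k c
        by (auto split: split_indicator)
    qed (use A k c in auto)
    also have "\<dots> \<le> ennreal k * 1 + ennreal (1 / 2 * c) * ennreal (e / (c + 1))"
      by (intro add_mono mult_left_mono d n) auto
    also have "\<dots> = ennreal (k + 1 / 2 * c * (e / (c + 1)))"
      using k c e by (simp add: ennreal_mult[symmetric])
    also have "\<dots> \<le> ennreal e"
    proof (intro ennreal_leI)
      have "c * (e / (c + 1)) \<le> e" using c e by (simp add: field_simps)
      moreover have "1 / 2 * c * (e / (c + 1)) = c * (e / (c + 1)) / 2" by simp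
      ultimately show "k + 1 / 2 * c * (e / (c + 1)) \<le> e" using k by linarith
    qed
    finally have le: "L1w_norm M m (\<lambda>x. indicator ?A x * ?g x) \<le> ennreal e" .
    have "\<bar>?g x\<bar> \<le> \<Phi> (real n)" if "x \<in> space M - ?A" for x
      using that young_quotient_nonneg[of 1 "f x"] young_mono[of "\<bar>f x\<bar>" "real n"] by auto
    then show "\<exists>A\<in>sets M. \<exists>B. (\<forall>x\<in>space M - A. \<bar>?g x\<bar> \<le> B) \<and>
        L1w_norm M m (\<lambda>x. indicator A x * ?g x) \<le> ennreal e"
      using A le by blast
  qed
  then show "f \<in> orlicz_space \<Phi> M (L1 M m)"
    unfolding orlicz_space_iff using fm zero_less_one by blast
qed

text \<open>The simple function approximates \<open>f\<close> cut off to
  \<open>{\<bar>f\<bar> \<le> n}\<close> and vanishes elsewhere. Where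
  \<open>\<bar>f\<bar> > n\<close>, the doubling condition bounds
  \<open>\<Phi>(\<bar>f\<bar> / k)\<close> by a multiple of
  \<open>\<Phi>(\<bar>f\<bar> / c)\<close>, whose tail is small; on the rest the error is at most
  \<open>a * k\<close>.\<close>

lemma orlicz_space_subset_LPhi:
  assumes "Delta2 \<Phi>"
  shows "orlicz_space \<Phi> M (L1 M m) \<subseteq> LPhi \<Phi> M m"
proof
  fix f assume "f \<in> orlicz_space \<Phi> M (L1 M m)"
  then obtain c where fm: "f \<in> borel_measurable M" and c: "0 < c" "(\<lambda>x. \<Phi> (\<bar>f x\<bar> / c)) \<in> L1 M m"
    unfolding orlicz_space_iff by blast
  let ?g = "\<lambda>x. \<Phi> (\<bar>f x\<bar> / c)"
  have gm: "?g \<in> borel_measurable M" by (rule borel_measurable_young[OF fm c(1)])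
  have "f \<in> LPhi_w \<Phi> M m"
    unfolding LPhi_w_eq orlicz_space_iff using fm c by (auto simp: L1_def)
  moreover have "\<exists>s. simple_function M s \<and> LPhi_w_norm \<Phi> M m (\<lambda>x. f x - s x) < ennreal e"
    if e: "0 < e" for e
  proof -
    \<comment> \<open>The norm estimate yields only \<open>\<le> k\<close>, while
      \<open>LPhi\<close> asks for a strict inequality.\<close>
    define k where "k = e / 2"
    have k: "0 < k" "k < e" using e by (auto simp: k_def)
    obtain C where C: "0 \<le> C" "\<And>t. 0 \<le> t \<Longrightarrow> \<Phi> (c / k * t) \<le> C * \<Phi> t"
      by (rule Delta2_scale[OF assms, of "c / k"]) (use c k that in auto)
    obtain K where K: "0 \<le> K" "L1w_norm M m (\<lambda>_. 1) = ennreal K"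
      by (rule semivariation_finite) (rule that)
    have "0 < 1 / (2 * (C + 1))" using C by simp
    then obtain n :: nat where
      n: "L1w_norm M m (\<lambda>x. indicator {x \<in> space M. real n < \<bar>f x\<bar>} x * ?g x) \<le> ennreal (1 / (2 * (C + 1)))"
      by (rule L1_tail[OF c(2) _ borel_measurable_abs[OF fm], rotated])
        (use that young_quotient_nonneg[OF c(1)] in auto)
    let ?A = "{x \<in> space M. real n < \<bar>f x\<bar>}"
    have A: "?A \<in> sets M" using fm by measurable
    \<comment> \<open>\<open>b\<close> makes the uniform error contribute at most 1/2 to the norm
      bound 1, the tail taking the other half. The cap at 1 in \<open>a\<close> is what convexity
      requires for \<open>\<Phi> a \<le> a * \<Phi> 1\<close>.\<close>
    define b where "b = 1 / (2 * (K + 1) * (\<Phi> 1 + 1))"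
    have \<Phi>1: "0 \<le> \<Phi> 1" by (rule young_nonneg) simp
    define a where "a = min 1 b"
    have b: "0 < b" unfolding b_def using K \<Phi>1 by simp
    then have a: "0 < a" "a \<le> 1" "a \<le> b" by (auto simp: a_def)
    define u where "u x = indicator (space M - ?A) x * f x" for x
    have um: "u \<in> borel_measurable M" unfolding u_def using A fm by measurable
    have ub: "\<bar>u x\<bar> \<le> real n" if "x \<in> space M" for x
      using that by (auto simp: u_def split: split_indicator)
    obtain s where s: "simple_function M s" "\<And>x. \<bar>u x - s x\<bar> \<le> a * k" "\<And>x. u x = 0 \<Longrightarrow> s x = 0"
      by (rule bounded_simple_approximation[OF um ub, of "a * k"]) (use a k that in auto)
    have sm: "s \<in> borel_measurable M" by (rule borel_measurable_simple_function[OF s(1)])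
    have dm: "(\<lambda>x. f x - s x) \<in> borel_measurable M" using fm sm by measurable
    have "L1w_norm M m (\<lambda>x. \<Phi> (\<bar>f x - s x\<bar> / k)) \<le>
        ennreal C * L1w_norm M m (\<lambda>x. indicator ?A x * ?g x) + ennreal (a * \<Phi> 1) * L1w_norm M m (\<lambda>_. 1)"
    proof (rule L1w_norm_le_add)
      fix x assume x: "x \<in> space M"
      have nn: "0 \<le> \<Phi> (\<bar>f x - s x\<bar> / k)" using young_quotient_nonneg[OF k(1)] .
      show "\<bar>\<Phi> (\<bar>f x - s x\<bar> / k)\<bar> \<le> C * \<bar>indicator ?A x * ?g x\<bar> + a * \<Phi> 1 * \<bar>1\<bar>"
      proof (cases "x \<in> ?A")
        case True
        then have "s x = 0" by (intro s(3)) (simp add: u_def)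
        then have "\<Phi> (\<bar>f x - s x\<bar> / k) \<le> C * ?g x"
          using C(2)[of "\<bar>f x\<bar> / c"] c(1) by simp
        moreover have "0 \<le> a * \<Phi> 1" using a \<Phi>1 by simp
        ultimately show ?thesis using True nn young_quotient_nonneg[OF c(1), of "f x"] by simp
      next
        case False
        then have "u x = f x" using x by (simp add: u_def)
        then have "\<bar>f x - s x\<bar> / k \<le> a * 1" using s(2)[of x] k by (simp add: field_simps)
        then have "\<Phi> (\<bar>f x - s x\<bar> / k) \<le> \<Phi> (a * 1)" using k by (intro young_mono) auto
        also have "\<dots> \<le> a * \<Phi> 1" using a by (intro young_scale) auto
        finally show ?thesis using False nn by simp
      qed
    qed (use A gm C a \<Phi>1 in auto)
    also have "\<dots> \<le> ennreal C * ennreal (1 / (2 * (C + 1))) + ennreal (a * \<Phi> 1) * ennreal K"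
      unfolding K(2) by (intro add_mono mult_left_mono n) auto
    also have "\<dots> = ennreal (C * (1 / (2 * (C + 1))) + a * \<Phi> 1 * K)"
      using C K a \<Phi>1 by (simp add: ennreal_mult[symmetric] ennreal_plus[symmetric] del: ennreal_plus)
    also have "\<dots> \<le> ennreal 1"
    proof (intro ennreal_leI)
      have "C * (1 / (2 * (C + 1))) \<le> 1 / 2" using C by (simp add: field_simps)
      moreover have "a * (\<Phi> 1 * K) \<le> b * ((\<Phi> 1 + 1) * (K + 1))"
        using a \<Phi>1 K by (intro mult_mono) auto
      moreover have "b * ((\<Phi> 1 + 1) * (K + 1)) = 1 / 2"
      proof -
        have "K + 1 \<noteq> 0" "\<Phi> 1 + 1 \<noteq> 0" using K \<Phi>1 by auto
        then show ?thesis by (simp add: b_def)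
      qed
      ultimately show "C * (1 / (2 * (C + 1))) + a * \<Phi> 1 * K \<le> 1"
        unfolding mult.assoc by linarith
    qed
    finally have "LPhi_w_norm \<Phi> M m (\<lambda>x. f x - s x) \<le> ennreal k"
      by (intro LPhi_w_norm_le[OF dm k(1)]) simp
    also have "\<dots> < ennreal e" using k by (simp add: ennreal_less_iff)
    finally show ?thesis using s(1) by blast
  qed
  ultimately show "f \<in> LPhi \<Phi> M m" by (simp add: LPhi_def)
qed

end

theorem proposition5p1:
  fixes \<Phi> :: "real \<Rightarrow> real"
    and M :: "'a measure"
    and m :: "'a set \<Rightarrow> 'b::banach"
  assumes "young_function \<Phi>"
    and "space M \<noteq> {}"
    and "vector_measure M m"
  shows "(LPhi_w \<Phi> M m = orlicz_space \<Phi> M (L1w M m) \<and>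
          (\<forall>f\<in>LPhi_w \<Phi> M m.
             LPhi_w_norm \<Phi> M m f = orlicz_norm \<Phi> M (L1w M m) (L1w_norm M m) f)) \<and>
         (LPhi \<Phi> M m \<subseteq> orlicz_space \<Phi> M (L1 M m) \<and>
          (Delta2 \<Phi> \<longrightarrow> LPhi \<Phi> M m = orlicz_space \<Phi> M (L1 M m)))"
proof -
  interpret vector_measure_young M m \<Phi>
    by unfold_locales (fact assms)+
  have "LPhi_w_norm \<Phi> M m f = orlicz_norm \<Phi> M (L1w M m) (L1w_norm M m) f"
    if "f \<in> LPhi_w \<Phi> M m" for f
    using that LPhi_w_norm_eq unfolding LPhi_w_iff by blast
  then show ?thesis
    using LPhi_w_eq LPhi_subset orlicz_space_subset_LPhi by blast
qed

end
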